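(* There exists a compact set $K\subseteq\mathbb{R}^2$ such that $K$ is an attractor of an iterated function system and the generic $f\in C(K)$ has a unique level set of Hausdorff dimension $\dim_{tH}K-1$ (that is, for the generic $f\in C(K)$ there is exactly one $y\in\mathbb{R}$ with $\dim_H f^{-1}(y)=\dim_{tH}K-1$).
   Context: A non-empty compact metric space $K$ is an attractor of an iterated function system if there exist finitely many contractions $\Psi_i\colon K\to K$, $i\in\{1,\dots,m\}$ (Lipschitz maps with Lipschitz constant $<1$) such that $K=\bigcup_{i=1}^m\Psi_i(K)$. The set $K\subseteq\mathbb{R}^2$ carries the Euclidean metric. $C(K)$ is the space of continuous functions $K\to\mathbb{R}$ with the supremum metric. "The generic $f\in C(K)$ has property $P$" means that the set of $f\in C(K)$ having $P$ is co-meager (its complement is a countable union of nowhere dense sets). $\dim_H$ is Hausdorff dimension, with the convention $\dim_H\emptyset=-1$. Topological Hausdorff dimension: $\dim_{tH}\emptyset=-1$, and for a non-empty metric space $X$, $\dim_{tH}X=\inf\{d: X$ has a basis $\mathcal{U}$ of open sets such that $\dim_H\partial U\le d-1$ for every $U\in\mathcal{U}\}$. *)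

theory Defs
  imports "HOL-Analysis.Analysis"
begin

section \<open>Hausdorff dimension\<close>

text \<open>
  The term \<open>(diam U) ^ s\<close> in the definition of the Hausdorff measure, with the conventions
  \<open>0 ^ 0 = 1\<close> for nonempty \<open>U\<close> and \<open>0\<close> for the empty set (in HOL, \<open>0 powr 0 = 0\<close>).
\<close>

definition diam_powr :: "real \<Rightarrow> 'a::metric_space set \<Rightarrow> ennreal" where
  "diam_powr s U =
     (if U = {} then 0 else if s = 0 then 1 else ennreal (diameter U powr s))"

text \<open>
  Boundedness of the covering sets is required explicitly, because \<^const>\<open>diameter\<close> is
  unspecified on unbounded sets.  Finite covers are included, since the \<open>U i\<close> may be empty.
\<close>

definition hausdorff_premeasure :: "real \<Rightarrow> real \<Rightarrow> 'a::metric_space set \<Rightarrow> ennreal" where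
  "hausdorff_premeasure s \<delta> A =
     (INF U \<in> {U :: nat \<Rightarrow> 'a set. A \<subseteq> (\<Union>i. U i) \<and> (\<forall>i. bounded (U i) \<and> diameter (U i) \<le> \<delta>)}.
        (\<Sum>i. diam_powr s (U i)))"

text \<open>The limit for \<open>\<delta>\<close> tending to \<open>0\<close> is a supremum, by monotonicity.\<close>

definition hausdorff_measure :: "real \<Rightarrow> 'a::metric_space set \<Rightarrow> ennreal" where
  "hausdorff_measure s A = (SUP \<delta> \<in> {0<..}. hausdorff_premeasure s \<delta> A)"

definition hausdorff_dim :: "'a::metric_space set \<Rightarrow> ereal" where
  "hausdorff_dim A =
     (if A = {} then -1 else Inf (ereal ` {s. 0 \<le> s \<and> hausdorff_measure s A = 0}))"


section \<open>Topological Hausdorff dimension\<close>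

text \<open>
  A subset \<open>A\<close> is regarded as a metric space in its own right, so open sets and boundaries are
  taken in the subspace topology of \<open>A\<close>.
\<close>

definition topological_hausdorff_dim :: "'a::metric_space set \<Rightarrow> ereal" where
  "topological_hausdorff_dim A =
     (if A = {} then -1
      else Inf {d. \<exists>\<B>. openin (top_of_set A) = arbitrary union_of (\<lambda>U. U \<in> \<B>) \<and>
                       (\<forall>U\<in>\<B>. hausdorff_dim (top_of_set A frontier_of U) \<le> d - 1)})"


section \<open>Attractors of iterated function systems\<close>

definition contraction_on :: "'a::metric_space set \<Rightarrow> ('a \<Rightarrow> 'a) \<Rightarrow> bool" where
  "contraction_on K \<psi> \<longleftrightarrow> \<psi> \<in> K \<rightarrow> K \<and> (\<exists>L<1. L-lipschitz_on K \<psi>)"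

definition ifs_attractor :: "'a::metric_space set \<Rightarrow> bool" where
  "ifs_attractor K \<longleftrightarrow> K \<noteq> {} \<and> compact K \<and>
     (\<exists>(m::nat) \<Psi>. (\<forall>i\<in>{1..m}. contraction_on K (\<Psi> i)) \<and> K = (\<Union>i\<in>{1..m}. \<Psi> i ` K))"


section \<open>Generic continuous functions\<close>

definition nowhere_dense_in :: "'a topology \<Rightarrow> 'a set \<Rightarrow> bool" where
  "nowhere_dense_in X S \<longleftrightarrow> S \<subseteq> topspace X \<and> X interior_of (X closure_of S) = {}"

definition meagre_in :: "'a topology \<Rightarrow> 'a set \<Rightarrow> bool" where
  "meagre_in X S \<longleftrightarrow> (\<exists>\<F>. countable \<F> \<and> (\<forall>N\<in>\<F>. nowhere_dense_in X N) \<and> S = \<Union>\<F>)"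

definition comeagre_in :: "'a topology \<Rightarrow> 'a set \<Rightarrow> bool" where
  "comeagre_in X S \<longleftrightarrow> S \<subseteq> topspace X \<and> meagre_in X (topspace X - S)"

text \<open>
  The metric space of bounded continuous real functions on \<open>K\<close> with the supremum metric;
  boundedness is automatic for compact \<open>K\<close>.  Its elements are extensional functions, that is,
  they have a fixed value outside \<open>K\<close>, and so correspond to the functions on \<open>K\<close>.
\<close>

abbreviation C_space :: "'a::metric_space set \<Rightarrow> ('a \<Rightarrow> real) metric" where
  "C_space K \<equiv> cfunspace (top_of_set K) euclidean_metric"

definition generic_C :: "'a::metric_space set \<Rightarrow> (('a \<Rightarrow> real) \<Rightarrow> bool) \<Rightarrow> bool" where
  "generic_C K P \<longleftrightarrow> comeagre_in (mtopology_of (C_space K)) {f \<in> mspace (C_space K). P f}"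

end

theory Submission
  imports Defs
begin

text \<open>
  The attractor \<open>K\<close> consists of a self-similar Cantor set of dimension \<open>4/3\<close> and of a \<open>comb\<close>: pieces
  \<open>[0,1] \<times> E\<^sub>n\<close>, rescaled so that they shrink to an apex \<open>p\<close>, where the Cantor sets
  \<open>E\<^sub>n \<subseteq> \<real>\<close> have dimensions increasing strictly to \<open>1/3\<close>.  The Cantor set is
  rich enough for a contraction that rearranges its digits to map it onto the comb, so \<open>K\<close> is an
  attractor although the dimensions in the comb increase towards \<open>p\<close>.  The boundary of a
  small neighbourhood of a point of the \<open>n\<close>-th piece meets many of its segments, hence
  \<open>dim\<^sub>t\<^sub>H K = 4/3\<close>.  A generic \<open>f\<close> is injective on the
  Cantor set, and its levels on the \<open>n\<close>-th piece have dimension bounded away from \<open>1/3\<close>.  A level other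
  than \<open>f p\<close> meets only finitely many pieces, so its dimension is less than \<open>1/3\<close>.  The level
  \<open>f p\<close> cuts through all segments of infinitely many pieces, so its dimension is \<open>1/3\<close>.
\<close>

section \<open>Hausdorff measure and dimension\<close>

text \<open>The obstacle is self-similarity. A similar copy of the comb would carry a second apex,
  whose level would generically have dimension 1/3 as well. Hence every map of the system collapses
  the whole comb to one point; only the Cantor set is copied, and the comb arises as the image of
  the Cantor set under a single map. The numbers come from counting bits. The Cantor set spends 4
  bits per factor 1/8, so its dimension is log 16 / log 8 = 4/3. Three bits pay for a full octal
  digit of the horizontal coordinate; the last one drives a two-branch vertical set of ratio at most
  1/8, whose dimension is at most 1/3. Ratios slightly below 1/8 keep each piece strictly below the
  limit dimension, so that 1/3 is reached only through infinitely many pieces. Since these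
  accumulate at the apex alone, only one level can use infinitely many of them. The Cantor set must
  not disturb the dimension of the comb: its coordinate projections are Lebesgue null, so rectangles
  can be placed with their sides off it.\<close>

lemma ennreal_le_suminf:
  fixes f :: "nat \<Rightarrow> ennreal"
  shows "f i \<le> suminf f"
  using sum_le_suminf[of f "{i}"] by simp

lemma diam_powr_pos: "s > 0 \<Longrightarrow> diam_powr s U = ennreal (diameter U powr s)"
  by (auto simp: diam_powr_def)

lemma hausdorff_measure_eq_0_iff:
  fixes A :: "'a::metric_space set"
  assumes s: "s > 0"
  shows "hausdorff_measure s A = 0 \<longleftrightarrow>
    (\<forall>\<epsilon>>0. \<exists>U :: nat \<Rightarrow> 'a set. A \<subseteq> (\<Union>i. U i) \<and> (\<forall>i. bounded (U i)) \<and>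
       (\<Sum>i. ennreal (diameter (U i) powr s)) < ennreal \<epsilon>)"
    (is "?L \<longleftrightarrow> (\<forall>\<epsilon>>0. \<exists>U. ?P \<epsilon> U)")
proof
  assume L: ?L
  show "\<forall>\<epsilon>>0. \<exists>U. ?P \<epsilon> U"
  proof (intro allI impI)
    fix \<epsilon> :: real assume e: "\<epsilon> > 0"
    have "hausdorff_premeasure s 1 A \<le> hausdorff_measure s A"
      unfolding hausdorff_measure_def by (rule SUP_upper) auto
    then have "hausdorff_premeasure s 1 A < ennreal \<epsilon>"
      using L e by simp
    then show "\<exists>U. ?P \<epsilon> U"
      unfolding hausdorff_premeasure_def using s
      by (auto simp: INF_less_iff diam_powr_pos)
  qed
next
  assume R: "\<forall>\<epsilon>>0. \<exists>U. ?P \<epsilon> U"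
  have le: "hausdorff_premeasure s \<delta> A \<le> ennreal \<epsilon>" if d: "\<delta> > 0" and e: "\<epsilon> > 0" for \<delta> \<epsilon>
  proof -
    \<comment> \<open>A sum below \<open>\<delta> powr s\<close> keeps each of its terms below that
      value, hence each diameter below \<delta>.\<close>
    define \<epsilon>' where "\<epsilon>' = min \<epsilon> (\<delta> powr s)"
    have e': "\<epsilon>' > 0" using d e by (simp add: \<epsilon>'_def)
    have "\<exists>U. ?P \<epsilon>' U" using R e' by simp
    then obtain U where U: "?P \<epsilon>' U" ..
    have "diameter (U i) \<le> \<delta>" for i
    proof -
      have "ennreal (diameter (U i) powr s) \<le> (\<Sum>i. ennreal (diameter (U i) powr s))"
        by (rule ennreal_le_suminf)
      also have "\<dots> < ennreal \<epsilon>'" using U by simp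
      finally have "diameter (U i) powr s < \<delta> powr s"
        using e' by (simp add: ennreal_less_iff \<epsilon>'_def)
      then show ?thesis
        using powr_mono2[of s \<delta> "diameter (U i)"] s d by linarith
    qed
    then have "hausdorff_premeasure s \<delta> A \<le> (\<Sum>i. diam_powr s (U i))"
      unfolding hausdorff_premeasure_def using U by (intro INF_lower) auto
    also have "\<dots> \<le> ennreal \<epsilon>'" using U s by (simp add: diam_powr_pos less_imp_le)
    also have "\<dots> \<le> ennreal \<epsilon>" by (simp add: \<epsilon>'_def ennreal_leI)
    finally show ?thesis .
  qed
  have "hausdorff_premeasure s \<delta> A \<le> 0" if "\<delta> > 0" for \<delta>
    by (rule ennreal_le_epsilon) (simp add: le that)
  then have "hausdorff_measure s A \<le> 0"
    unfolding hausdorff_measure_def by (intro SUP_least) simp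
  then show ?L by simp
qed

lemma hausdorff_measure_0_eq_0D:
  assumes "hausdorff_measure 0 A = 0"
  shows "A = {}"
proof (rule ccontr)
  assume A: "A \<noteq> {}"
  have "hausdorff_premeasure 0 1 A \<le> hausdorff_measure 0 A"
    unfolding hausdorff_measure_def by (rule SUP_upper) auto
  then have "hausdorff_premeasure 0 1 A < 1"
    using assms by simp
  then obtain U where U: "A \<subseteq> (\<Union>i. U i)" "(\<Sum>i. diam_powr 0 (U i)) < 1"
    unfolding hausdorff_premeasure_def by (auto simp: INF_less_iff)
  obtain i where "U i \<noteq> {}" using A U(1) by fastforce
  then have "(1::ennreal) \<le> (\<Sum>i. diam_powr 0 (U i))"
    using ennreal_le_suminf[of "\<lambda>i. diam_powr 0 (U i)" i] by (simp add: diam_powr_def)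
  then show False using U(2) by simp
qed

lemma hausdorff_measure_empty: "s > 0 \<Longrightarrow> hausdorff_measure s {} = 0"
  by (subst hausdorff_measure_eq_0_iff) (auto intro!: exI[of _ "\<lambda>_. {}"])

text \<open>A covering sum below 1 consists of sets of diameter at most 1, and for these the larger
  exponent gives the smaller term.\<close>

lemma hausdorff_null_mono_exponent:
  assumes "hausdorff_measure t A = 0" and "0 \<le> t" "t \<le> s" "0 < s"
  shows "hausdorff_measure s A = 0"
proof (cases "t = 0")
  case True
  then show ?thesis using assms hausdorff_measure_0_eq_0D hausdorff_measure_empty by blast
next
  case False
  then have t: "t > 0" using assms by simp
  show ?thesis
    unfolding hausdorff_measure_eq_0_iff[OF \<open>0 < s\<close>]
  proof (intro allI impI)
    fix \<epsilon> :: real assume "\<epsilon> > 0"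
    then have "min 1 \<epsilon> > 0" by simp
    with assms(1) t obtain U where U: "A \<subseteq> (\<Union>i. U i)" "\<And>i. bounded (U i)"
       "(\<Sum>i. ennreal (diameter (U i) powr t)) < ennreal (min 1 \<epsilon>)"
      unfolding hausdorff_measure_eq_0_iff[OF t] by blast
    have "diameter (U i) powr s \<le> diameter (U i) powr t" for i
    proof -
      have "ennreal (diameter (U i) powr t) \<le> (\<Sum>i. ennreal (diameter (U i) powr t))"
        by (rule ennreal_le_suminf)
      also note U(3)
      finally have "diameter (U i) powr t < 1 powr t"
        using \<open>\<epsilon> > 0\<close> by (simp add: ennreal_less_iff)
      then have "diameter (U i) \<le> 1"
        using powr_mono2[of t 1 "diameter (U i)"] t by linarith
      then show ?thesis
        using diameter_ge_0[OF U(2), of i] assms by (intro powr_mono') auto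
    qed
    then have "(\<Sum>i. ennreal (diameter (U i) powr s)) \<le> (\<Sum>i. ennreal (diameter (U i) powr t))"
      by (intro suminf_le) (auto intro: ennreal_leI)
    also have "\<dots> < ennreal \<epsilon>"
      using U(3) by (rule order_less_le_trans) (simp add: ennreal_leI)
    finally show "\<exists>U. A \<subseteq> (\<Union>i. U i) \<and> (\<forall>i. bounded (U i)) \<and>
       (\<Sum>i. ennreal (diameter (U i) powr s)) < ennreal \<epsilon>" using U by blast
  qed
qed

lemma hausdorff_null_subset:
  assumes "hausdorff_measure s B = 0" "A \<subseteq> B" "s > 0"
  shows "hausdorff_measure s A = 0"
  using assms unfolding hausdorff_measure_eq_0_iff[OF \<open>s > 0\<close>] by (meson order_trans)

lemma hausdorff_null_UN:
  fixes A :: "nat \<Rightarrow> 'a::metric_space set"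
  assumes s: "s > 0" and A: "\<And>n. hausdorff_measure s (A n) = 0"
  shows "hausdorff_measure s (\<Union>n. A n) = 0"
  unfolding hausdorff_measure_eq_0_iff[OF s]
proof (intro allI impI)
  fix \<epsilon> :: real assume e: "\<epsilon> > 0"
  \<comment> \<open>The budgets add up to \<epsilon>/2, not \<epsilon>: summing the strict bounds
    yields only a weak one, and the remaining half restores strictness.\<close>
  have "\<exists>U. A n \<subseteq> (\<Union>i. U i) \<and> (\<forall>i. bounded (U i)) \<and>
       (\<Sum>i. ennreal (diameter (U i) powr s)) < ennreal (\<epsilon>/2 * (1/2)^Suc n)" for n
    using A[of n] e unfolding hausdorff_measure_eq_0_iff[OF s] by simp
  then obtain U where U: "\<And>n. A n \<subseteq> (\<Union>i. U n i)" "\<And>n i. bounded (U n i)"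
    "\<And>n. (\<Sum>i. ennreal (diameter (U n i) powr s)) < ennreal (\<epsilon>/2 * (1/2)^Suc n)"
    by metis
  define V where "V = (\<lambda>k. case prod_decode k of (n, i) \<Rightarrow> U n i)"
  have "(\<Union>n. A n) \<subseteq> (\<Union>k. V k)"
  proof
    fix x assume "x \<in> (\<Union>n. A n)"
    then obtain n i where "x \<in> U n i" using U(1) by blast
    then have "x \<in> V (prod_encode (n, i))" by (simp add: V_def)
    then show "x \<in> (\<Union>k. V k)" by blast
  qed
  moreover have "\<forall>k. bounded (V k)" using U(2) by (auto simp: V_def split: prod.split)
  moreover have "(\<Sum>k. ennreal (diameter (V k) powr s)) < ennreal \<epsilon>"
  proof -
    have "(\<Sum>k. ennreal (diameter (V k) powr s))
        = (\<Sum>k. (\<lambda>(n, i). ennreal (diameter (U n i) powr s)) (prod_decode k))"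
      by (intro suminf_cong) (auto simp: V_def split: prod.split)
    also have "\<dots> = (\<Sum>n i. ennreal (diameter (U n i) powr s))"
      by (subst suminf_ennreal_2dimen[where g="\<lambda>n. \<Sum>i. ennreal (diameter (U n i) powr s)"]) auto
    also have "\<dots> \<le> (\<Sum>n. ennreal (\<epsilon>/2 * (1/2)^Suc n))"
      using U(3) by (intro suminf_le) (auto intro: less_imp_le)
    also have "\<dots> = ennreal (\<epsilon>/2)"
      using sums_mult[OF power_half_series, of "\<epsilon>/2"] e
      by (intro suminf_ennreal_eq) auto
    also have "\<dots> < ennreal \<epsilon>" using e by (simp add: ennreal_less_iff)
    finally show ?thesis .
  qed
  ultimately show "\<exists>U. (\<Union>n. A n) \<subseteq> (\<Union>i. U i) \<and> (\<forall>i. bounded (U i)) \<and>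
       (\<Sum>i. ennreal (diameter (U i) powr s)) < ennreal \<epsilon>" by blast
qed

lemma hausdorff_null_Un:
  assumes "s > 0" "hausdorff_measure s A = 0" "hausdorff_measure s B = 0"
  shows "hausdorff_measure s (A \<union> B) = 0"
proof -
  have "hausdorff_measure s (\<Union>n::nat. if n = 0 then A else B) = 0"
    using assms by (intro hausdorff_null_UN) auto
  moreover have "(\<Union>n::nat. if n = 0 then A else B) = A \<union> B"
    by (auto split: if_splits)
  ultimately show ?thesis by simp
qed

text \<open>Bridge from finitely many cells of uniform size to the sequence covers above. The
  sequence is padded with empty sets, which contribute 0 because \<open>s\<close> is
  positive.\<close>

lemma finite_cover_powr_sum:
  fixes V :: "'b \<Rightarrow> 'a::metric_space set"
  assumes I: "finite I" and A: "A \<subseteq> (\<Union>i\<in>I. V i)"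
    and V: "\<And>i x y. \<lbrakk>i \<in> I; x \<in> V i; y \<in> V i\<rbrakk> \<Longrightarrow> dist x y \<le> D"
    and D: "D \<ge> 0" and s: "s > 0" and le: "real (card I) * D powr s < \<epsilon>"
  shows "\<exists>U :: nat \<Rightarrow> 'a set. A \<subseteq> (\<Union>i. U i) \<and> (\<forall>i. bounded (U i)) \<and>
       (\<Sum>i. ennreal (diameter (U i) powr s)) < ennreal \<epsilon>"
proof -
  obtain h where h: "bij_betw h {0..<card I} I"
    using ex_bij_betw_nat_finite[OF I] by blast
  define U where "U = (\<lambda>k. if k < card I then V (h k) else {})"
  have hI: "h k \<in> I" if "k < card I" for k
    using h that by (auto simp: bij_betw_def)
  have "A \<subseteq> (\<Union>k. U k)"
  proof
    fix x assume "x \<in> A"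
    then obtain i where i: "i \<in> I" "x \<in> V i" using A by blast
    then obtain k where "k < card I" "h k = i"
      using h unfolding bij_betw_def by (metis atLeastLessThan_iff imageE)
    then show "x \<in> (\<Union>k. U k)" using i by (auto simp: U_def)
  qed
  moreover have dU: "dist x y \<le> D" if "x \<in> U k" "y \<in> U k" for k x y
    using that V[OF hI, of k x y] by (auto simp: U_def split: if_splits)
  then have bU: "bounded (U k)" for k
    by (metis bounded_def ex_in_conv)
  moreover have "(\<Sum>k. ennreal (diameter (U k) powr s)) < ennreal \<epsilon>"
  proof -
    have "(\<Sum>k. ennreal (diameter (U k) powr s)) = (\<Sum>k<card I. ennreal (diameter (U k) powr s))"
      using s by (intro suminf_finite) (auto simp: U_def)
    also have "\<dots> \<le> (\<Sum>k<card I. ennreal (D powr s))"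
    proof (intro sum_mono ennreal_leI powr_mono2)
      fix k
      show "0 \<le> diameter (U k)" by (rule diameter_ge_0[OF bU])
      show "diameter (U k) \<le> D"
        unfolding diameter_def using dU D by (auto intro!: cSUP_least)
    qed (use s in auto)
    also have "\<dots> = ennreal (real (card I) * D powr s)"
      by (simp add: ennreal_mult ennreal_of_nat_eq_real_of_nat)
    also have "\<dots> < ennreal \<epsilon>"
      using le by (simp add: ennreal_less_iff)
    finally show ?thesis .
  qed
  ultimately show ?thesis by blast
qed

lemma hausdorff_dim_le:
  assumes "hausdorff_measure s A = 0" "0 \<le> s"
  shows "hausdorff_dim A \<le> ereal s"
proof (cases "A = {}")
  case True
  then show ?thesis using assms by (simp add: hausdorff_dim_def order_trans[of "-1" 0])
next
  case False
  then show ?thesis using assms by (auto simp: hausdorff_dim_def intro!: Inf_lower)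
qed

text \<open>A cover of \<open>A\<close> induces a cover of [0,1] by balls of radius
  \<open>(c * diameter (U i)) powr s\<close>. Since [0,1] has length 1, no covering sum can fall
  below \<open>1 / (2 * c powr s)\<close>. Balls around chosen parameters replace the preimages of
  the \<open>U i\<close>, which might not be measurable.\<close>

lemma hausdorff_dim_ge:
  fixes a :: "real \<Rightarrow> 'a::metric_space"
  assumes s: "s > 0" and c: "c > 0" and a: "\<And>z. z \<in> {0..1} \<Longrightarrow> a z \<in> A"
    and expand: "\<And>z z'. \<lbrakk>z \<in> {0..1}; z' \<in> {0..1}\<rbrakk> \<Longrightarrow> \<bar>z - z'\<bar> \<le> (c * dist (a z) (a z')) powr s"
  shows "hausdorff_dim A \<ge> ereal s"
proof -
  have nz: "hausdorff_measure s A \<noteq> 0"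
  proof
    assume "hausdorff_measure s A = 0"
    moreover have "1 / (2 * c powr s) > 0" using c by simp
    ultimately obtain U where U: "A \<subseteq> (\<Union>i. U i)" "\<And>i. bounded (U i)"
       "(\<Sum>i. ennreal (diameter (U i) powr s)) < ennreal (1 / (2 * c powr s))"
      unfolding hausdorff_measure_eq_0_iff[OF s] by blast
    define r where "r = (\<lambda>i. (c * diameter (U i)) powr s)"
    \<comment> \<open>If no parameter is sent into \<open>U i\<close>, then \<open>v i\<close> is
      arbitrary; its ball has radius \<open>r i\<close> all the same, which the sum accounts
      for.\<close>
    define v where "v = (\<lambda>i. SOME z. z \<in> {0..1} \<and> a z \<in> U i)"
    have cov: "{0..1} \<subseteq> (\<Union>i. cball (v i) (r i))"
    proof
      fix z :: real assume z: "z \<in> {0..1}"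
      then obtain i where i: "a z \<in> U i" using a U(1) by blast
      then have v: "v i \<in> {0..1} \<and> a (v i) \<in> U i"
        unfolding v_def using z by (intro someI_ex[of "\<lambda>z. z \<in> {0..1} \<and> a z \<in> U i"]) blast
      have "\<bar>v i - z\<bar> \<le> (c * dist (a (v i)) (a z)) powr s"
        using expand v z by blast
      also have "\<dots> \<le> r i"
        unfolding r_def using c s v i U(2) diameter_bounded_bound[of "U i" "a (v i)" "a z"]
        by (intro powr_mono2 mult_left_mono mult_nonneg_nonneg) auto
      finally show "z \<in> (\<Union>i. cball (v i) (r i))" by (auto simp: dist_real_def)
    qed
    have "ennreal 1 = emeasure lborel {0..1::real}" by simp
    also have "\<dots> \<le> emeasure lborel (\<Union>i. cball (v i) (r i))"
      using cov by (intro emeasure_mono) auto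
    also have "\<dots> \<le> (\<Sum>i. emeasure lborel (cball (v i) (r i)))"
      by (intro emeasure_subadditive_countably) auto
    also have "\<dots> = (\<Sum>i. ennreal (2 * c powr s) * ennreal (diameter (U i) powr s))"
    proof (intro suminf_cong)
      fix i
      have "emeasure lborel (cball (v i) (r i)) = ennreal (2 * r i)"
        by (simp add: cball_eq_atLeastAtMost r_def)
      also have "2 * r i = (2 * c powr s) * diameter (U i) powr s"
        using c diameter_ge_0[OF U(2)] by (simp add: r_def powr_mult)
      finally show "emeasure lborel (cball (v i) (r i))
          = ennreal (2 * c powr s) * ennreal (diameter (U i) powr s)"
        by (simp add: ennreal_mult)
    qed
    also have "\<dots> = ennreal (2 * c powr s) * (\<Sum>i. ennreal (diameter (U i) powr s))"
      by (simp add: ennreal_suminf_cmult)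
    also have "\<dots> < ennreal (2 * c powr s) * ennreal (1 / (2 * c powr s))"
      using U(3) c by (intro ennreal_mult_strict_left_mono) (auto simp: top_unique)
    also have "\<dots> = ennreal 1" using c by (simp add: ennreal_mult[symmetric])
    finally show False by simp
  qed
  have "A \<noteq> {}" using a[of 0] by auto
  moreover have "s \<le> t" if "0 \<le> t" "hausdorff_measure t A = 0" for t
    using nz hausdorff_null_mono_exponent[OF that(2,1), of s] s by linarith
  ultimately show ?thesis
    by (auto simp: hausdorff_dim_def intro!: Inf_greatest)
qed


section \<open>Digit expansions\<close>

definition bounded_digits :: "nat \<Rightarrow> (nat \<Rightarrow> nat) set" where
  "bounded_digits D = {d. \<forall>k. d k \<le> D}"

lemma bounded_digitsD: "d \<in> bounded_digits D \<Longrightarrow> d k \<le> D"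
  by (simp add: bounded_digits_def)

lemma bounded_digits_shift [simp]:
  assumes "d \<in> bounded_digits D"
  shows "(\<lambda>k. d (k + m)) \<in> bounded_digits D" "(\<lambda>k. d (Suc k)) \<in> bounded_digits D"
    "(\<lambda>k. d (Suc (k + m))) \<in> bounded_digits D"
  using assms by (simp_all add: bounded_digits_def)

lemma zero_digits [simp]: "(\<lambda>_. 0) \<in> bounded_digits D"
  by (simp add: bounded_digits_def)

definition digit_sum :: "real \<Rightarrow> (nat \<Rightarrow> nat) \<Rightarrow> real" where
  "digit_sum r d = (\<Sum>k. real (d k) * r ^ k)"

lemma digit_sum_summable:
  assumes "0 \<le> r" "r < 1" "d \<in> bounded_digits D"
  shows "summable (\<lambda>k. real (d k) * r ^ k)"
proof (rule summable_comparison_test')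
  show "summable (\<lambda>k. real D * r ^ k)"
    using assms by (intro summable_mult summable_geometric) auto
  show "norm (real (d k) * r ^ k) \<le> real D * r ^ k" for k
    using assms bounded_digitsD[of d D k] by (simp add: abs_mult mult_right_mono)
qed

lemma digit_sum_split:
  assumes "0 \<le> r" "r < 1" "d \<in> bounded_digits D"
  shows "digit_sum r d = (\<Sum>k<m. real (d k) * r ^ k) + r ^ m * digit_sum r (\<lambda>k. d (k + m))"
proof -
  have "(\<Sum>k. r ^ m * (real (d (k + m)) * r ^ k)) = r ^ m * digit_sum r (\<lambda>k. d (k + m))"
    unfolding digit_sum_def
    by (rule suminf_mult) (use assms in \<open>simp add: digit_sum_summable[of r "\<lambda>k. d (k + m)" D]\<close>)
  then show ?thesis
    using suminf_split_initial_segment[OF digit_sum_summable[of r d D], of m] assms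
    by (simp add: digit_sum_def power_add mult_ac)
qed

lemma digit_sum_Suc:
  assumes "0 \<le> r" "r < 1" "d \<in> bounded_digits D"
  shows "digit_sum r d = real (d 0) + r * digit_sum r (\<lambda>k. d (Suc k))"
  using digit_sum_split[of r d D 1] assms by simp

lemma digit_sum_bounds:
  assumes "0 \<le> r" "r < 1" "d \<in> bounded_digits D"
  shows "0 \<le> digit_sum r d" "digit_sum r d \<le> real D / (1 - r)"
proof -
  have sm: "summable (\<lambda>k. real (d k) * r ^ k)" using assms by (rule digit_sum_summable)
  show "0 \<le> digit_sum r d"
    unfolding digit_sum_def using sm assms by (intro suminf_nonneg) auto
  have "(\<lambda>k. real D * r ^ k) sums (real D * (1 / (1 - r)))"
    using assms by (intro sums_mult geometric_sums) auto
  moreover have "real (d k) * r ^ k \<le> real D * r ^ k" for k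
    using assms bounded_digitsD[of d D k] by (simp add: mult_right_mono)
  ultimately show "digit_sum r d \<le> real D / (1 - r)"
    unfolding digit_sum_def using sums_le[OF _ summable_sums[OF sm]] by fastforce
qed

lemma digit_sum_diff_le:
  assumes r: "0 \<le> r" "r < 1" and d: "d \<in> bounded_digits D" and d': "d' \<in> bounded_digits D"
    and eq: "\<And>k. k < m \<Longrightarrow> d k = d' k"
  shows "\<bar>digit_sum r d - digit_sum r d'\<bar> \<le> real D / (1 - r) * r ^ m"
proof -
  let ?X = "digit_sum r (\<lambda>k. d (k + m))" and ?Y = "digit_sum r (\<lambda>k. d' (k + m))"
  have "digit_sum r d - digit_sum r d' = r ^ m * (?X - ?Y)"
    using digit_sum_split[of r d D m] digit_sum_split[of r d' D m] eq r d d'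
    by (simp add: algebra_simps)
  moreover have "\<bar>?X - ?Y\<bar> \<le> real D / (1 - r)"
    using digit_sum_bounds[OF r, of "\<lambda>k. d (k + m)" D] digit_sum_bounds[OF r, of "\<lambda>k. d' (k + m)" D] d d'
    by auto
  then have "r ^ m * \<bar>?X - ?Y\<bar> \<le> r ^ m * (real D / (1 - r))"
    using r by (intro mult_left_mono) auto
  ultimately show ?thesis
    using r by (simp add: abs_mult mult.commute)
qed

text \<open>At the first difference the digits differ by at least 1, while the tails can make up for
  at most \<open>r * (D / (1 - r))\<close>. When that is below 1, distinct codes give distinct,
  quantitatively separated sums.\<close>

lemma digit_sum_diff_ge:
  assumes r: "0 \<le> r" "r < 1" and d: "d \<in> bounded_digits D" and d': "d' \<in> bounded_digits D"
    and eq: "\<And>k. k < m \<Longrightarrow> d k = d' k" and neq: "d m \<noteq> d' m"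
  shows "\<bar>digit_sum r d - digit_sum r d'\<bar> \<ge> (1 - r * (real D / (1 - r))) * r ^ m"
proof -
  let ?X = "digit_sum r (\<lambda>k. d (Suc k + m))" and ?Y = "digit_sum r (\<lambda>k. d' (Suc k + m))"
  have "digit_sum r d - digit_sum r d' = r ^ m * ((real (d m) - real (d' m)) + r * (?X - ?Y))"
    using digit_sum_split[of r d D m] digit_sum_split[of r d' D m] eq
      digit_sum_Suc[OF r, of "\<lambda>k. d (k + m)" D] digit_sum_Suc[OF r, of "\<lambda>k. d' (k + m)" D] r d d'
    by (simp add: algebra_simps)
  moreover have "\<bar>real (d m) - real (d' m)\<bar> \<ge> 1" using neq by linarith
  moreover have "\<bar>?X - ?Y\<bar> \<le> real D / (1 - r)"
    using digit_sum_bounds[OF r, of "\<lambda>k. d (Suc k + m)" D]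
      digit_sum_bounds[OF r, of "\<lambda>k. d' (Suc k + m)" D] d d'
    by auto
  then have "\<bar>r * (?X - ?Y)\<bar> \<le> r * (real D / (1 - r))"
    unfolding abs_mult using r by (simp add: mult_left_mono del: times_divide_eq_right)
  ultimately have "\<bar>(real (d m) - real (d' m)) + r * (?X - ?Y)\<bar> \<ge> 1 - r * (real D / (1 - r))"
    by linarith
  then have "r ^ m * \<bar>(real (d m) - real (d' m)) + r * (?X - ?Y)\<bar> \<ge> r ^ m * (1 - r * (real D / (1 - r)))"
    using r by (intro mult_left_mono) auto
  then show ?thesis
    unfolding \<open>digit_sum r d - digit_sum r d' = _\<close> abs_mult using r by (simp add: mult.commute)
qed

lemma ex_digit_expansion:
  fixes q :: nat
  assumes q: "q \<ge> 2" and x: "0 \<le> x" "x \<le> 1"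
  shows "\<exists>d. d \<in> bounded_digits (q - 1) \<and> x = digit_sum (1 / real q) d / real q"
proof (cases "x = 1")
  case True
  \<comment> \<open>The floors used in the other case would give \<open>x = 1\<close> an integer
    part 1, for which the expansion has no place.\<close>
  have "(\<lambda>k. real (q - 1) * (1 / real q) ^ k) sums (real (q - 1) * (1 / (1 - 1 / real q)))"
    using q by (intro sums_mult geometric_sums) auto
  then have "digit_sum (1 / real q) (\<lambda>_. q - 1) = real (q - 1) * (1 / (1 - 1 / real q))"
    unfolding digit_sum_def by (rule sums_unique[symmetric])
  also have "\<dots> = real q" using q by (simp add: field_simps of_nat_diff)
  finally show ?thesis
    using True q by (intro exI[of _ "\<lambda>_. q - 1"]) (simp add: bounded_digits_def)
next
  case False
  define F where "F = (\<lambda>k. \<lfloor>real q ^ k * x\<rfloor>)"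
  define d where "d = (\<lambda>k. nat (F (Suc k) - int q * F k))"
  have fl: "F (Suc k) - int q * F k \<ge> 0" "F (Suc k) - int q * F k < int q" for k
  proof -
    have "real_of_int (F k) \<le> real q ^ k * x" "real q ^ k * x < real_of_int (F k) + 1"
      unfolding F_def by linarith+
    then have a: "real q * real_of_int (F k) \<le> real q ^ Suc k * x"
      "real q ^ Suc k * x < real q * (real_of_int (F k) + 1)"
      using q by (simp_all add: mult.assoc)
    have "real_of_int (int q * F k) \<le> real q ^ Suc k * x" using a(1) by simp
    then show "F (Suc k) - int q * F k \<ge> 0" unfolding F_def by (simp add: le_floor_iff)
    have "real q ^ Suc k * x < real_of_int (int q * (F k + 1))" using a(2) by simp
    then have "F (Suc k) < int q * (F k + 1)" unfolding F_def by (simp only: floor_less_iff)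
    then show "F (Suc k) - int q * F k < int q" by (simp add: algebra_simps)
  qed
  have rd: "real (d k) = real_of_int (F (Suc k)) - real q * real_of_int (F k)" for k
    unfolding d_def using fl(1)[of k] by simp
  have F0: "F 0 = 0" using x False by (simp add: F_def floor_eq_iff)
  \<comment> \<open>The digits are the increments \<open>F (Suc k) - q * F k\<close>, so the partial
    sums telescope.\<close>
  have part: "(\<Sum>k<m. real (d k) * (1 / real q) ^ k) = real q * (real_of_int (F m) / real q ^ m)" for m
  proof (induction m)
    case (Suc m)
    then show ?case using q by (simp add: rd field_simps)
  qed (simp add: F0)
  have "(\<lambda>m. real_of_int (F m) / real q ^ m) \<longlonglongrightarrow> x"
  proof (rule tendsto_sandwich[of "\<lambda>m. x - (1 / real q) ^ m" _ _ "\<lambda>_. x"])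
    have "x - (1 / real q) ^ m \<le> real_of_int (F m) / real q ^ m" for m
    proof -
      have "real q ^ m * x - 1 \<le> real_of_int (F m)" unfolding F_def by linarith
      then have "(real q ^ m * x - 1) / real q ^ m \<le> real_of_int (F m) / real q ^ m"
        by (intro divide_right_mono) auto
      then show ?thesis using q by (simp add: diff_divide_distrib power_one_over)
    qed
    then show "\<forall>\<^sub>F m in sequentially. x - (1 / real q) ^ m \<le> real_of_int (F m) / real q ^ m"
      by (intro always_eventually allI)
    have "real_of_int (F m) \<le> real q ^ m * x" for m unfolding F_def by linarith
    then show "\<forall>\<^sub>F m in sequentially. real_of_int (F m) / real q ^ m \<le> x"
      using q by (intro always_eventually) (auto simp: field_simps)
    have "(\<lambda>m. x - (1 / real q) ^ m) \<longlonglongrightarrow> x - 0"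
      using q by (intro tendsto_intros LIMSEQ_realpow_zero) auto
    then show "(\<lambda>m. x - (1 / real q) ^ m) \<longlonglongrightarrow> x" by simp
  qed auto
  then have "(\<lambda>m. real q * (real_of_int (F m) / real q ^ m)) \<longlonglongrightarrow> real q * x"
    by (intro tendsto_intros)
  then have "(\<lambda>k. real (d k) * (1 / real q) ^ k) sums (real q * x)"
    unfolding sums_def part .
  then have "digit_sum (1 / real q) d = real q * x"
    unfolding digit_sum_def by (rule sums_unique[symmetric])
  moreover have "d k \<le> q - 1" for k
    unfolding d_def using fl[of k] q by linarith
  ultimately show ?thesis using q by (intro exI[of _ d]) (simp add: bounded_digits_def)
qed

text \<open>The digit sequences are compact by Tychonoff, and \<open>digit_sum r\<close> is a
  uniform limit of partial sums that depend on finitely many discrete coordinates.\<close>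

lemma compact_digit_sums:
  assumes r: "0 \<le> r" "r < 1"
  shows "compact (digit_sum r ` bounded_digits D)"
proof (rule compact_continuous_image)
  have "bounded_digits D = Pi\<^sub>E UNIV (\<lambda>k::nat. {..D})" by (auto simp: PiE_def bounded_digits_def)
  moreover have "compact (Pi\<^sub>E UNIV (\<lambda>k::nat. {..D}))"
    using compactin_PiE[of "\<lambda>k::nat. (euclidean :: nat topology)" UNIV "\<lambda>_. {..D}"]
    by (simp add: euclidean_product_topology finite_imp_compact)
  ultimately show "compact (bounded_digits D)" by simp
  have "uniform_limit (bounded_digits D) (\<lambda>m d. \<Sum>k<m. real (d k) * r ^ k) (\<lambda>d. \<Sum>k. real (d k) * r ^ k) sequentially"
  proof (rule Weierstrass_m_test)
    show "summable (\<lambda>k. real D * r ^ k)"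
      using r by (intro summable_mult summable_geometric) auto
    show "norm (real (d k) * r ^ k) \<le> real D * r ^ k" if "d \<in> bounded_digits D" for k d
      using that r bounded_digitsD[of d D k] by (simp add: abs_mult mult_right_mono)
  qed
  moreover have "continuous_on (bounded_digits D) (\<lambda>d. \<Sum>k<m. real (d k) * r ^ k)" for m
  proof (intro continuous_on_sum continuous_on_mult continuous_on_const)
    fix k :: nat
    have "continuous_on UNIV (\<lambda>d :: nat \<Rightarrow> nat. d k)" by (rule continuous_on_product_coordinates)
    then have "continuous_on UNIV (real \<circ> (\<lambda>d :: nat \<Rightarrow> nat. d k))"
      by (rule continuous_on_compose) (auto intro: continuous_on_discrete)
    then show "continuous_on (bounded_digits D) (\<lambda>d :: nat \<Rightarrow> nat. real (d k))"
      by (auto intro: continuous_on_subset simp: o_def)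
  qed
  ultimately show "continuous_on (bounded_digits D) (digit_sum r)"
    unfolding digit_sum_def[abs_def]
    by (intro uniform_limit_theorem[of _ "\<lambda>m d. \<Sum>k<m. real (d k) * r ^ k"]) auto
qed

lemma first_difference:
  fixes d d' :: "nat \<Rightarrow> 'a"
  assumes "d \<noteq> d'"
  obtains m where "\<And>k. k < m \<Longrightarrow> d k = d' k" "d m \<noteq> d' m"
proof -
  from assms have "\<exists>k. d k \<noteq> d' k" by auto
  then show ?thesis
    using that[of "LEAST k. d k \<noteq> d' k"] LeastI_ex[of "\<lambda>k. d k \<noteq> d' k"] not_less_Least by blast
qed

text \<open>The set of digit sums is the union of \<open>D + 1\<close> translates of its image under scaling by \<open>r\<close>.\<close>

lemma negligible_digit_sums:
  assumes r: "0 < r" and D: "(real D + 1) * r < 1"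
  shows "negligible (digit_sum r ` bounded_digits D)" (is "negligible ?E")
proof -
  have r1: "r < 1" using r D by (smt (verit) mult_less_cancel_right2 of_nat_0_le_iff)
  have lm: "?E \<in> lmeasurable"
    using r r1 by (intro lmeasurable_compact compact_digit_sums) auto
  have sub: "?E \<subseteq> (\<Union>i\<in>{..D}. (\<lambda>x. real i + r * x) ` ?E)"
  proof
    fix x assume "x \<in> ?E"
    then obtain d where d: "d \<in> bounded_digits D" "x = digit_sum r d" by blast
    then have "x = real (d 0) + r * digit_sum r (\<lambda>k. d (Suc k))"
      using digit_sum_Suc[of r d D] r r1 by simp
    then show "x \<in> (\<Union>i\<in>{..D}. (\<lambda>x. real i + r * x) ` ?E)"
      using bounded_digitsD[OF d(1), of 0] bounded_digits_shift(2)[OF d(1)] by blast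
  qed
  have im: "(\<lambda>x. real i + r * x) ` ?E \<in> lmeasurable"
    "measure lebesgue ((\<lambda>x. real i + r * x) ` ?E) = r * measure lebesgue ?E" for i
  proof -
    have *: "(\<lambda>x. real i + r * x) ` ?E = (+) (real i) ` ((*\<^sub>R) r ` ?E)" by (auto simp: image_image)
    show "(\<lambda>x. real i + r * x) ` ?E \<in> lmeasurable"
      unfolding * by (intro measurable_translation lmeasurable_compact compact_scaling compact_digit_sums) (use r r1 in auto)
    show "measure lebesgue ((\<lambda>x. real i + r * x) ` ?E) = r * measure lebesgue ?E"
      using measure_lebesgue_affine[of r "real i" ?E] r by (simp add: add.commute)
  qed
  have "measure lebesgue ?E \<le> measure lebesgue (\<Union>i\<in>{..D}. (\<lambda>x. real i + r * x) ` ?E)"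
    using sub lm im by (intro measure_mono_fmeasurable) (auto intro: fmeasurable.finite_UN)
  also have "\<dots> \<le> (\<Sum>i\<in>{..D}. measure lebesgue ((\<lambda>x. real i + r * x) ` ?E))"
    using im by (intro measure_UNION_le) auto
  also have "\<dots> = ((real D + 1) * r) * measure lebesgue ?E" using im(2) by simp
  finally have "(1 - (real D + 1) * r) * measure lebesgue ?E \<le> 0" by (simp add: algebra_simps)
  then have "measure lebesgue ?E = 0"
    using D measure_nonneg[of lebesgue ?E] by (smt (verit) mult_pos_pos)
  then show ?thesis using lm by (simp add: negligible_iff_measure)
qed


section \<open>The attractor\<close>

abbreviation pt :: "real \<Rightarrow> real \<Rightarrow> real ^ 2" where
  "pt x y \<equiv> vector [x, y]"

lemma dist_le_coords: "dist z w \<le> \<bar>z $ 1 - w $ 1\<bar> + \<bar>z $ 2 - w $ 2\<bar>" for z w :: "real ^ 2"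
  using norm_le_l1_cart[of "z - w"] by (simp add: dist_norm sum_2)

lemma coord_le_dist: "\<bar>z $ i - w $ i\<bar> \<le> dist z w" for z w :: "real ^ 2"
  by (metis dist_norm norm_bound_component_le_cart vector_minus_component order_refl)

lemma continuous_on_pt [continuous_intros]:
  assumes "continuous_on S f" "continuous_on S g"
  shows "continuous_on S (\<lambda>x. pt (f x) (g x))"
proof -
  have "continuous_on S (\<lambda>x. \<chi> i::2. if i = 1 then f x else g x)"
  proof (rule continuous_on_vec_lambda)
    show "continuous_on S (\<lambda>x. if i = 1 then f x else g x)" for i :: 2
      using assms by (cases "i = 1") auto
  qed
  moreover have "(\<chi> i::2. if i = 1 then a else b) = pt a b" for a b
    by (simp add: vec_eq_iff forall_2)
  ultimately show ?thesis by simp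
qed

text \<open>Dimension of the vertical Cantor set of the \<open>n\<close>-th piece. The reciprocal
  form makes its contraction ratio equal to 1/8 times
  \<open>(1/2) powr (1 / (n + 1))\<close>.\<close>

definition level_dim :: "nat \<Rightarrow> real" where
  "level_dim n = 1 / (3 + 1 / (real n + 1))"

text \<open>Solution \<open>r\<close> of the Moran equation
  \<open>2 * r powr level_dim n = 1\<close> for two branches.\<close>

definition ratio :: "nat \<Rightarrow> real" where
  "ratio n = (1/2) powr (1 / level_dim n)"

text \<open>Selecting the piece \<open>n\<close> uses up \<open>n + 1\<close> digits of the Cantor
  code, which accounts for \<open>(1/8) ^ (n + 1)\<close>; the further 1/64 is room for the
  contraction constant.\<close>

definition piece_scale :: "nat \<Rightarrow> real" where
  "piece_scale n = (1/8) ^ (n + 3)"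

definition cantor :: "(real ^ 2) set" where
  "cantor = (\<lambda>(c, c'). pt (digit_sum (1/8) c) (digit_sum (1/8) c')) ` (bounded_digits 3 \<times> bounded_digits 3)"

text \<open>The offset 20 puts the comb far from the Cantor set. The summand 1 lifts the piece off
  height 0, so that different pieces occupy disjoint ranges of heights.\<close>

definition piece_pt :: "nat \<Rightarrow> real \<Rightarrow> (nat \<Rightarrow> nat) \<Rightarrow> real ^ 2" where
  "piece_pt n x b = pt (20 + piece_scale n * x) (piece_scale n * (1 + digit_sum (ratio n) b))"

definition piece :: "nat \<Rightarrow> (real ^ 2) set" where
  "piece n = {piece_pt n x b | x b. x \<in> {0..1} \<and> b \<in> bounded_digits 1}"

definition apex :: "real ^ 2" where
  "apex = pt 20 0"

definition comb :: "(real ^ 2) set" where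
  "comb = insert apex (\<Union>n. piece n)"

definition K_set :: "(real ^ 2) set" where
  "K_set = cantor \<union> comb"

section \<open>Sizes and positions of the Cantor set and the pieces\<close>

lemma level_dim_bounds: "0 < level_dim n" "level_dim n < 1/3"
  by (simp_all add: level_dim_def field_simps)

lemma level_dim_mono: "m < n \<Longrightarrow> level_dim m < level_dim n"
proof -
  assume "m < n"
  then have "1 / (real n + 1) < 1 / (real m + 1)" by (simp add: frac_less2)
  then show ?thesis
    unfolding level_dim_def by (intro divide_strict_left_mono) (auto intro!: mult_pos_pos add_pos_pos)
qed

lemma level_dim_tendsto: "level_dim \<longlonglongrightarrow> 1/3"
proof -
  have "(\<lambda>n. 1 / (3 + 1 / real (Suc n))) \<longlonglongrightarrow> 1 / (3 + 0)"
    using LIMSEQ_Suc[OF lim_1_over_n[where 'a=real]] by (intro tendsto_intros) auto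
  then show ?thesis unfolding level_dim_def[abs_def] by (simp add: add.commute)
qed

lemma ratio_bounds: "0 < ratio n" "ratio n \<le> 1/8"
proof -
  show "0 < ratio n" by (simp add: ratio_def)
  have "ratio n \<le> (1/2) powr 3"
    unfolding ratio_def by (intro powr_mono') (auto simp: level_dim_def)
  then show "ratio n \<le> 1/8" by (simp add: powr_numeral power3_eq_cube)
qed

lemma ratio_powr: "ratio n powr level_dim n = 1/2"
  using level_dim_bounds[of n] by (simp add: ratio_def powr_powr)

lemma piece_scale_bounds: "0 < piece_scale n" "piece_scale n \<le> 1/512"
proof -
  show "0 < piece_scale n" by (simp add: piece_scale_def)
  have "(1/8::real) ^ (n + 3) \<le> (1/8) ^ 3" by (intro power_decreasing) auto
  then show "piece_scale n \<le> 1/512" by (simp add: piece_scale_def power3_eq_cube)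
qed

lemma piece_scale_add: "piece_scale (n + j) = piece_scale n * (1/8) ^ j"
  by (simp add: piece_scale_def power_add)

lemma piece_scale_mono: "k \<le> n \<Longrightarrow> piece_scale n \<le> piece_scale k"
  unfolding piece_scale_def by (intro power_decreasing) auto

lemma digit_sum_ratio_bounds:
  assumes "b \<in> bounded_digits 1"
  shows "0 \<le> digit_sum (ratio n) b" "digit_sum (ratio n) b \<le> 8/7"
proof -
  note r = ratio_bounds[of n]
  show "0 \<le> digit_sum (ratio n) b"
    using digit_sum_bounds(1)[of "ratio n" b 1] assms r by simp
  have "digit_sum (ratio n) b \<le> 1 / (1 - ratio n)"
    using digit_sum_bounds(2)[of "ratio n" b 1] assms r by simp
  also have "\<dots> \<le> 1 / (1 - 1/8)" using r by (intro divide_left_mono) auto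
  finally show "digit_sum (ratio n) b \<le> 8/7" by simp
qed

lemma piece_pt_nth [simp]:
  "piece_pt n x b $ 1 = 20 + piece_scale n * x"
  "piece_pt n x b $ 2 = piece_scale n * (1 + digit_sum (ratio n) b)"
  by (simp_all add: piece_pt_def)

lemma piece_bounds:
  assumes "z \<in> piece n"
  shows "20 \<le> z $ 1" "z $ 1 \<le> 20 + piece_scale n" "piece_scale n \<le> z $ 2" "z $ 2 \<le> 15/7 * piece_scale n"
proof -
  obtain x b where z: "z = piece_pt n x b" and x: "x \<in> {0..1}" and b: "b \<in> bounded_digits 1"
    using assms by (auto simp: piece_def)
  have "piece_scale n * digit_sum (ratio n) b \<le> piece_scale n * (8/7)"
    using digit_sum_ratio_bounds[OF b] piece_scale_bounds[of n] by (intro mult_left_mono) auto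
  moreover have "0 \<le> piece_scale n * digit_sum (ratio n) b"
    using digit_sum_ratio_bounds[OF b] piece_scale_bounds[of n] by simp
  moreover have "0 \<le> piece_scale n * x" "piece_scale n * x \<le> piece_scale n"
    using x piece_scale_bounds[of n] by (auto simp: mult_left_le)
  ultimately show "20 \<le> z $ 1" "z $ 1 \<le> 20 + piece_scale n" "piece_scale n \<le> z $ 2" "z $ 2 \<le> 15/7 * piece_scale n"
    by (simp_all add: z distrib_left)
qed

lemma comb_fst: "z \<in> comb \<Longrightarrow> 20 \<le> z $ 1 \<and> z $ 1 \<le> 21"
proof -
  assume "z \<in> comb"
  then consider "z = apex" | n where "z \<in> piece n" by (auto simp: comb_def)
  then show ?thesis
  proof cases
    case (2 n)
    then show ?thesis using piece_bounds[of z n] piece_scale_bounds[of n] by linarith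
  qed (simp add: apex_def)
qed

lemma cantor_coords:
  assumes "z \<in> cantor"
  shows "0 \<le> z $ i \<and> z $ i \<le> 24/7"
proof -
  obtain c c' where "z = pt (digit_sum (1/8) c) (digit_sum (1/8) c')"
    "c \<in> bounded_digits 3" "c' \<in> bounded_digits 3"
    using assms by (auto simp: cantor_def)
  then show ?thesis
    using digit_sum_bounds[of "1/8" c 3] digit_sum_bounds[of "1/8" c' 3] exhaust_2[of i] by auto
qed

lemma cantor_comb_dist:
  assumes "z \<in> cantor" "w \<in> comb"
  shows "dist z w \<ge> 16"
  using cantor_coords[OF assms(1), of 1] comb_fst[OF assms(2)] coord_le_dist[of z 1 w] by linarith

text \<open>Each of the two coordinates contributes 24/7 = 3 / (1 - 1/8).\<close>

lemma cantor_dist_le: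
  assumes "c \<in> bounded_digits 3" "c' \<in> bounded_digits 3" "d \<in> bounded_digits 3" "d' \<in> bounded_digits 3"
    and "\<And>j. j < k \<Longrightarrow> c j = d j \<and> c' j = d' j"
  shows "dist (pt (digit_sum (1/8) c) (digit_sum (1/8) c')) (pt (digit_sum (1/8) d) (digit_sum (1/8) d'))
    \<le> 48/7 * (1/8) ^ k"
  using dist_le_coords[of "pt (digit_sum (1/8) c) (digit_sum (1/8) c')" "pt (digit_sum (1/8) d) (digit_sum (1/8) d')"]
    digit_sum_diff_le[of "1/8" c 3 d k] digit_sum_diff_le[of "1/8" c' 3 d' k] assms
  by simp

text \<open>Here 4/7 = 1 - 24/56 is the constant of \<open>digit_sum_diff_ge\<close>; a difference
  in one coordinate is enough.\<close>

lemma cantor_dist_ge: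
  assumes "c \<in> bounded_digits 3" "c' \<in> bounded_digits 3" "d \<in> bounded_digits 3" "d' \<in> bounded_digits 3"
    and "\<And>j. j < k \<Longrightarrow> c j = d j \<and> c' j = d' j" and "c k \<noteq> d k \<or> c' k \<noteq> d' k"
  shows "dist (pt (digit_sum (1/8) c) (digit_sum (1/8) c')) (pt (digit_sum (1/8) d) (digit_sum (1/8) d'))
    \<ge> 4/7 * (1/8) ^ k"
  using assms(6)
proof
  assume "c k \<noteq> d k"
  then show ?thesis
    using coord_le_dist[of "pt (digit_sum (1/8) c) (digit_sum (1/8) c')" 1 "pt (digit_sum (1/8) d) (digit_sum (1/8) d')"]
    digit_sum_diff_ge[of "1/8" c 3 d k] assms by simp
next
  assume "c' k \<noteq> d' k"
  then show ?thesis
    using coord_le_dist[of "pt (digit_sum (1/8) c) (digit_sum (1/8) c')" 2 "pt (digit_sum (1/8) d) (digit_sum (1/8) d')"]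
    digit_sum_diff_ge[of "1/8" c' 3 d' k] assms by simp
qed

section \<open>Codes of the points of the Cantor set\<close>

lemma cantor_code_cases:
  fixes c c' d d' :: "nat \<Rightarrow> nat"
  obtains "c = d" "c' = d'"
  | k where "\<And>j. j < k \<Longrightarrow> c j = d j \<and> c' j = d' j" "c k \<noteq> d k \<or> c' k \<noteq> d' k"
proof (cases "(\<lambda>k. (c k, c' k)) = (\<lambda>k. (d k, d' k))")
  case True
  then have "c = d" "c' = d'" by (auto simp: fun_eq_iff)
  then show ?thesis by (rule that(1))
next
  case False
  then obtain k where "\<And>j. j < k \<Longrightarrow> (c j, c' j) = (d j, d' j)" "(c k, c' k) \<noteq> (d k, d' k)"
    by (rule first_difference) blast
  then show ?thesis by (intro that(2)[of k]) auto
qed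

definition cantor_code :: "real ^ 2 \<Rightarrow> (nat \<Rightarrow> nat) \<times> (nat \<Rightarrow> nat)" where
  "cantor_code z = (SOME (c, c'). c \<in> bounded_digits 3 \<and> c' \<in> bounded_digits 3 \<and>
     z = pt (digit_sum (1/8) c) (digit_sum (1/8) c'))"

lemma cantor_codeE:
  assumes "z \<in> cantor"
  obtains c c' where "cantor_code z = (c, c')" "c \<in> bounded_digits 3" "c' \<in> bounded_digits 3"
     "z = pt (digit_sum (1/8) c) (digit_sum (1/8) c')"
proof -
  have "\<exists>p. case p of (c, c') \<Rightarrow> c \<in> bounded_digits 3 \<and> c' \<in> bounded_digits 3 \<and>
     z = pt (digit_sum (1/8) c) (digit_sum (1/8) c')"
    using assms by (auto simp: cantor_def)
  from someI_ex[OF this, folded cantor_code_def] show ?thesis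
    using that by (auto split: prod.splits)
qed

text \<open>By \<open>cantor_dist_ge\<close> different codes belong to different points, so the
  choice in \<open>cantor_code\<close> is forced.\<close>

lemma cantor_code_pt:
  assumes "c \<in> bounded_digits 3" "c' \<in> bounded_digits 3"
  shows "cantor_code (pt (digit_sum (1/8) c) (digit_sum (1/8) c')) = (c, c')" (is "cantor_code ?z = _")
proof -
  have "?z \<in> cantor" using assms by (auto simp: cantor_def)
  then obtain d d' where d: "cantor_code ?z = (d, d')" "d \<in> bounded_digits 3" "d' \<in> bounded_digits 3"
     "?z = pt (digit_sum (1/8) d) (digit_sum (1/8) d')"
    by (rule cantor_codeE)
  show ?thesis
  proof (cases rule: cantor_code_cases[of c d c' d'])
    case (2 k)
    then have "4/7 * (1/8) ^ k \<le> dist ?z (pt (digit_sum (1/8) d) (digit_sum (1/8) d'))"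
      using assms d(2,3) by (intro cantor_dist_ge)
    also have "\<dots> = 0" using d(4) by simp
    finally have "(1/8::real) ^ k \<le> 0" by simp
    moreover have "(1/8::real) ^ k > 0" by simp
    ultimately show ?thesis by linarith
  qed (use d in simp)
qed

text \<open>Truncating the code to \<open>m\<close> digit pairs splits the Cantor set into finitely
  many small cells with gaps between them. A function constant on the cells is therefore continuous
  and can be given different values on different cells.\<close>

lemma cantor_zero_dimensional:
  assumes "\<delta> > 0"
  obtains r :: "real ^ 2 \<Rightarrow> (nat \<times> nat) list" and \<eta> where "\<eta> > 0" "finite (r ` cantor)"
    "\<And>a b. \<lbrakk>a \<in> cantor; b \<in> cantor; dist a b < \<eta>\<rbrakk> \<Longrightarrow> r a = r b"
    "\<And>a b. \<lbrakk>a \<in> cantor; b \<in> cantor; r a = r b\<rbrakk> \<Longrightarrow> dist a b < \<delta>"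
proof -
  obtain m where m: "(1/8::real) ^ m < \<delta> * 7/48"
    using real_arch_pow_inv[of "\<delta> * 7/48" "1/8"] assms by auto
  define r where "r = (\<lambda>z. map (\<lambda>k. (fst (cantor_code z) k, snd (cantor_code z) k)) [0..<m])"
  show ?thesis
  proof (rule that[of "4/7 * (1/8) ^ m" r])
    show "4/7 * (1/8::real) ^ m > 0" by simp
    have "r ` cantor \<subseteq> {xs. set xs \<subseteq> {..3} \<times> {..3} \<and> length xs = m}"
    proof
      fix xs assume "xs \<in> r ` cantor"
      then obtain z where z: "z \<in> cantor" "xs = r z" by auto
      then show "xs \<in> {xs. set xs \<subseteq> {..3} \<times> {..3} \<and> length xs = m}"
        by (elim cantor_codeE) (auto simp: r_def bounded_digitsD)
    qed
    then show "finite (r ` cantor)"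
      by (rule finite_subset) (intro finite_lists_length_eq finite_cartesian_product finite_atMost)
  next
    fix a b assume a: "a \<in> cantor" and b: "b \<in> cantor"
    obtain c c' where c: "cantor_code a = (c, c')" "c \<in> bounded_digits 3" "c' \<in> bounded_digits 3"
     "a = pt (digit_sum (1/8) c) (digit_sum (1/8) c')" using a by (rule cantor_codeE)
    obtain d d' where d: "cantor_code b = (d, d')" "d \<in> bounded_digits 3" "d' \<in> bounded_digits 3"
     "b = pt (digit_sum (1/8) d) (digit_sum (1/8) d')" using b by (rule cantor_codeE)
    show "r a = r b" if dist: "dist a b < 4/7 * (1/8) ^ m"
    proof (cases rule: cantor_code_cases[of c d c' d'])
      case (2 k)
      then have "4/7 * (1/8) ^ k \<le> dist a b"
        unfolding c(4) d(4) using c(2,3) d(2,3) by (intro cantor_dist_ge)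
      then have "4/7 * (1/8) ^ k < 4/7 * (1/8::real) ^ m" using dist by linarith
      then have "m < k" using power_decreasing[of k m "1/8::real"] by (cases "k \<le> m") auto
      then show ?thesis using 2(1) by (auto simp: r_def c(1) d(1))
    qed (simp add: r_def c(1) d(1))
    show "dist a b < \<delta>" if "r a = r b"
    proof -
      have "c j = d j \<and> c' j = d' j" if "j < m" for j
        using \<open>r a = r b\<close> that by (simp add: r_def c(1) d(1))
      then have "dist a b \<le> 48/7 * (1/8) ^ m"
        unfolding c(4) d(4) using c(2,3) d(2,3) by (intro cantor_dist_le)
      then show ?thesis using m by simp
    qed
  qed
qed

section \<open>Folding the Cantor set onto the comb\<close>

text \<open>
  A pair of base-8 digits \<open>c, c' \<le> 3\<close> carries four bits: three of them form a base-8 digit of the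
  horizontal coordinate in a piece, the last one is a digit of the vertical coordinate.  The position
  of the first nonzero vertical digit selects the piece.
\<close>

definition fold_code :: "(nat \<Rightarrow> nat) \<Rightarrow> (nat \<Rightarrow> nat) \<Rightarrow> real ^ 2" where
  "fold_code c c' =
     (if \<forall>k. c' k mod 2 = 0 then apex
      else let n = (LEAST k. c' k mod 2 \<noteq> 0)
           in piece_pt n (digit_sum (1/8) (\<lambda>k. c (k + n + 1) + 4 * (c' (k + n + 1) div 2)) / 8)
                (\<lambda>k. c' (k + n + 1) mod 2))"

lemma fold_code_eq:
  assumes "\<And>j. j < n \<Longrightarrow> c' j mod 2 = 0" "c' n mod 2 \<noteq> 0"
  shows "fold_code c c' =
     piece_pt n (digit_sum (1/8) (\<lambda>k. c (k + n + 1) + 4 * (c' (k + n + 1) div 2)) / 8)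
                (\<lambda>k. c' (k + n + 1) mod 2)"
proof -
  have "(LEAST k. c' k mod 2 \<noteq> 0) = n"
    using assms by (intro Least_equality) (auto simp: not_less[symmetric])
  then show ?thesis using assms(2) unfolding fold_code_def Let_def by auto
qed

lemma folded_digits:
  assumes "c \<in> bounded_digits 3" "c' \<in> bounded_digits 3"
  shows "(\<lambda>k. c (k + n + 1) + 4 * (c' (k + n + 1) div 2)) \<in> bounded_digits 7"
    "(\<lambda>k. c' (k + n + 1) mod 2) \<in> bounded_digits 1"
proof -
  have "c j + 4 * (c' j div 2) \<le> 7" for j
    using bounded_digitsD[OF assms(1), of j] div_le_mono[OF bounded_digitsD[OF assms(2), of j], of 2] by simp
  then show "(\<lambda>k. c (k + n + 1) + 4 * (c' (k + n + 1) div 2)) \<in> bounded_digits 7"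
    unfolding bounded_digits_def by blast
  have "c' j mod 2 \<le> 1" for j
    using mod_less_divisor[of 2 "c' j"] by linarith
  then show "(\<lambda>k. c' (k + n + 1) mod 2) \<in> bounded_digits 1"
    unfolding bounded_digits_def by blast
qed

lemma octal_in_unit:
  assumes "e \<in> bounded_digits 7"
  shows "digit_sum (1/8) e / 8 \<in> {0..1}"
  using digit_sum_bounds[of "1/8" e 7] assms by auto

lemma fold_code_in_comb:
  assumes "c \<in> bounded_digits 3" "c' \<in> bounded_digits 3"
    and "\<And>j. j < k \<Longrightarrow> c' j mod 2 = 0"
  shows "fold_code c c' = apex \<or> (\<exists>n\<ge>k. fold_code c c' \<in> piece n)"
proof (cases "\<forall>j. c' j mod 2 = 0")
  case True
  then show ?thesis by (simp add: fold_code_def)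
next
  case False
  define n where "n = (LEAST j. c' j mod 2 \<noteq> 0)"
  have n: "c' n mod 2 \<noteq> 0" "\<And>j. j < n \<Longrightarrow> c' j mod 2 = 0"
    unfolding n_def using False LeastI_ex[of "\<lambda>j. c' j mod 2 \<noteq> 0"] not_less_Least by blast+
  have "n \<ge> k" using n(1) assms(3) by (meson not_less)
  moreover have "fold_code c c' \<in> piece n"
    using fold_code_eq[of n c' c] n folded_digits[OF assms(1,2), of n] octal_in_unit
    unfolding piece_def by blast
  ultimately show ?thesis by blast
qed

lemma fold_code_close_to_apex:
  assumes "c \<in> bounded_digits 3" "c' \<in> bounded_digits 3"
    and "\<And>j. j < k \<Longrightarrow> c' j mod 2 = 0"
  shows "20 \<le> fold_code c c' $ 1" "fold_code c c' $ 1 \<le> 20 + piece_scale k"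
    "0 \<le> fold_code c c' $ 2" "fold_code c c' $ 2 \<le> 15/7 * piece_scale k"
proof -
  have "20 \<le> fold_code c c' $ 1 \<and> fold_code c c' $ 1 \<le> 20 + piece_scale k \<and>
    0 \<le> fold_code c c' $ 2 \<and> fold_code c c' $ 2 \<le> 15/7 * piece_scale k"
    using fold_code_in_comb[of c c' k, OF assms]
  proof
    assume "\<exists>n\<ge>k. fold_code c c' \<in> piece n"
    then obtain n where "n \<ge> k" "fold_code c c' \<in> piece n" by blast
    then show ?thesis
      using piece_bounds[of "fold_code c c'" n] piece_scale_mono[of k n] piece_scale_bounds(1)[of n] by linarith
  next
    assume "fold_code c c' = apex"
    then have "fold_code c c' $ 1 = 20" "fold_code c c' $ 2 = 0" by (simp_all add: apex_def)
    then show ?thesis using piece_scale_bounds(1)[of k] by linarith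
  qed
  then show "20 \<le> fold_code c c' $ 1" "fold_code c c' $ 1 \<le> 20 + piece_scale k"
    "0 \<le> fold_code c c' $ 2" "fold_code c c' $ 2 \<le> 15/7 * piece_scale k" by auto
qed

text \<open>If the common prefix carries no vertical bit, both images lie within a box of size about
  \<open>piece_scale k\<close> at the apex. Otherwise the prefix fixes the piece, and every further
  common digit shrinks both coordinate differences by at least 1/8, because \<open>ratio n\<close>
  is at most 1/8.\<close>

lemma fold_code_lipschitz:
  assumes c: "c \<in> bounded_digits 3" "c' \<in> bounded_digits 3" and d: "d \<in> bounded_digits 3" "d' \<in> bounded_digits 3"
    and eq: "\<And>j. j < k \<Longrightarrow> c j = d j \<and> c' j = d' j"
  shows "dist (fold_code c c') (fold_code d d') \<le> 2/7 * (1/8) ^ k"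
proof (cases "\<forall>j<k. c' j mod 2 = 0")
  case True
  then have T: "\<And>j. j < k \<Longrightarrow> c' j mod 2 = 0" "\<And>j. j < k \<Longrightarrow> d' j mod 2 = 0"
    using eq by auto
  have "dist (fold_code c c') (fold_code d d') \<le> piece_scale k + 15/7 * piece_scale k"
    using dist_le_coords[of "fold_code c c'" "fold_code d d'"]
      fold_code_close_to_apex[of c c' k, OF c T(1)] fold_code_close_to_apex[of d d' k, OF d T(2)] by linarith
  also have "\<dots> \<le> 2/7 * (1/8) ^ k" by (simp add: piece_scale_def power_add power3_eq_cube)
  finally show ?thesis .
next
  case False
  define n where "n = (LEAST j. c' j mod 2 \<noteq> 0)"
  have n: "c' n mod 2 \<noteq> 0" "\<And>j. j < n \<Longrightarrow> c' j mod 2 = 0"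
    unfolding n_def using False LeastI_ex[of "\<lambda>j. c' j mod 2 \<noteq> 0"] not_less_Least by blast+
  have nk: "n < k" using False n(2) by (metis linorder_neqE_nat n_def not_less_Least order.strict_trans)
  then have n': "d' n mod 2 \<noteq> 0" "\<And>j. j < n \<Longrightarrow> d' j mod 2 = 0" using n eq by auto
  \<comment> \<open>The digits 0 to \<open>n\<close> are spent on selecting the piece;
    \<open>j\<close> of the \<open>k\<close> common digits are left for the coordinates.\<close>
  obtain j where j: "k = n + 1 + j" using nk less_iff_Suc_add by auto
  have eq': "c (i + n + 1) = d (i + n + 1)" "c' (i + n + 1) = d' (i + n + 1)" if "i < j" for i
    using eq[of "i + n + 1"] that j by auto
  let ?x = "\<lambda>c c'. digit_sum (1/8) (\<lambda>k. c (k + n + 1) + 4 * (c' (k + n + 1) div 2))"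
  let ?y = "\<lambda>c'. digit_sum (ratio n) (\<lambda>k. c' (k + n + 1) mod 2)"
  note s = piece_scale_bounds[of n] and r = ratio_bounds[of n]
  have "\<bar>?x c c' - ?x d d'\<bar> \<le> real 7 / (1 - 1/8) * (1/8) ^ j"
    using folded_digits(1)[OF c] folded_digits(1)[OF d] eq'
    by (intro digit_sum_diff_le) auto
  then have "piece_scale n * \<bar>?x c c' / 8 - ?x d d' / 8\<bar> \<le> piece_scale n * (1/8) ^ j"
    using s by (intro mult_left_mono) (auto simp flip: diff_divide_distrib)
  moreover have "\<bar>?y c' - ?y d'\<bar> \<le> 8/7 * (1/8) ^ j"
  proof -
    have "\<bar>?y c' - ?y d'\<bar> \<le> real 1 / (1 - ratio n) * ratio n ^ j"
      using r folded_digits(2)[OF c] folded_digits(2)[OF d] eq'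
      by (intro digit_sum_diff_le) auto
    also have "\<dots> \<le> 1 / (1 - 1/8) * (1/8) ^ j"
      using r by (intro mult_mono frac_le power_mono) auto
    finally show ?thesis by simp
  qed
  then have "piece_scale n * \<bar>?y c' - ?y d'\<bar> \<le> piece_scale n * (8/7 * (1/8) ^ j)"
    using s by (intro mult_left_mono) auto
  moreover have "dist (fold_code c c') (fold_code d d') \<le>
    piece_scale n * \<bar>?x c c' / 8 - ?x d d' / 8\<bar> + piece_scale n * \<bar>?y c' - ?y d'\<bar>"
  proof -
    have "fold_code c c' = piece_pt n (?x c c' / 8) (\<lambda>k. c' (k + n + 1) mod 2)"
      by (rule fold_code_eq) (use n in auto)
    moreover have "fold_code d d' = piece_pt n (?x d d' / 8) (\<lambda>k. d' (k + n + 1) mod 2)"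
      by (rule fold_code_eq) (use n' in auto)
    ultimately have "dist (fold_code c c') (fold_code d d') \<le>
      \<bar>piece_scale n * (?x c c' / 8) - piece_scale n * (?x d d' / 8)\<bar> + \<bar>piece_scale n * ?y c' - piece_scale n * ?y d'\<bar>"
      using dist_le_coords[of "fold_code c c'" "fold_code d d'"]
      by (simp only: piece_pt_nth distrib_left add_diff_cancel_left)
    also have "\<dots> = piece_scale n * \<bar>?x c c' / 8 - ?x d d' / 8\<bar> + piece_scale n * \<bar>?y c' - ?y d'\<bar>"
      unfolding right_diff_distrib[symmetric] abs_mult using s by simp
    finally show ?thesis .
  qed
  ultimately have "dist (fold_code c c') (fold_code d d') \<le> 15/7 * (piece_scale n * (1/8) ^ j)" by linarith
  also have "\<dots> \<le> 2/7 * (1/8) ^ k" by (simp add: j piece_scale_def power_add power3_eq_cube)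
  finally show ?thesis .
qed

lemma fold_code_zero: "fold_code c (\<lambda>_. 0) = apex"
  unfolding fold_code_def by (rule if_P) simp

lemma digit_sum_zero [simp]: "digit_sum r (\<lambda>_. 0) = 0"
  by (simp add: digit_sum_def)

lemma pt_zero: "pt 0 0 = 0"
  by (simp add: vec_eq_iff forall_2)

definition cantor_fold :: "real ^ 2 \<Rightarrow> real ^ 2" where
  "cantor_fold z = (case cantor_code z of (c, c') \<Rightarrow> fold_code c c')"

text \<open>Points whose codes first differ at \<open>k\<close> are \<open>4/7 * (1/8) ^ k\<close>
  apart, twice the bound \<open>2/7 * (1/8) ^ k\<close> for their images.\<close>

lemma cantor_fold_lipschitz:
  assumes a: "a \<in> cantor" and b: "b \<in> cantor"
  shows "dist (cantor_fold a) (cantor_fold b) \<le> 1/2 * dist a b"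
proof -
  obtain c c' where c: "cantor_code a = (c, c')" "c \<in> bounded_digits 3" "c' \<in> bounded_digits 3"
    "a = pt (digit_sum (1/8) c) (digit_sum (1/8) c')" using a by (rule cantor_codeE)
  obtain d d' where d: "cantor_code b = (d, d')" "d \<in> bounded_digits 3" "d' \<in> bounded_digits 3"
    "b = pt (digit_sum (1/8) d) (digit_sum (1/8) d')" using b by (rule cantor_codeE)
  show ?thesis
  proof (cases rule: cantor_code_cases[of c d c' d'])
    case (2 k)
    then have "4/7 * (1/8) ^ k \<le> dist a b"
      unfolding c(4) d(4) using c(2,3) d(2,3) by (intro cantor_dist_ge)
    moreover have "dist (cantor_fold a) (cantor_fold b) \<le> 2/7 * (1/8) ^ k"
      unfolding cantor_fold_def c(1) d(1) prod.case using c(2,3) d(2,3) 2(1) by (rule fold_code_lipschitz)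
    ultimately show ?thesis by linarith
  qed (simp add: cantor_fold_def c(1) d(1))
qed

lemma cantor_fold_image: "cantor_fold ` cantor = comb"
proof
  show "cantor_fold ` cantor \<subseteq> comb"
  proof
    fix w assume "w \<in> cantor_fold ` cantor"
    then obtain z where z: "z \<in> cantor" "w = cantor_fold z" by auto
    from z(1) obtain c c' where "cantor_code z = (c, c')" "c \<in> bounded_digits 3" "c' \<in> bounded_digits 3"
      by (rule cantor_codeE)
    then show "w \<in> comb"
      using fold_code_in_comb[of c c' 0] by (auto simp: z(2) cantor_fold_def comb_def)
  qed
  have onto: "fold_code c c' \<in> cantor_fold ` cantor"
    if "c \<in> bounded_digits 3" "c' \<in> bounded_digits 3" for c c'
    using that by (intro image_eqI[of _ _ "pt (digit_sum (1/8) c) (digit_sum (1/8) c')"])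
      (auto simp: cantor_fold_def cantor_code_pt cantor_def)
  show "comb \<subseteq> cantor_fold ` cantor"
  proof
    fix w assume "w \<in> comb"
    then consider "w = apex" | n where "w \<in> piece n" by (auto simp: comb_def)
    then show "w \<in> cantor_fold ` cantor"
    proof cases
      case 1
      then show ?thesis
        using onto[OF zero_digits zero_digits] by (simp only: fold_code_zero)
    next
      case 2
      then obtain x b where w: "w = piece_pt n x b" and x: "x \<in> {0..1}" and b: "b \<in> bounded_digits 1"
        by (auto simp: piece_def)
      obtain e where e: "e \<in> bounded_digits 7" "x = digit_sum (1/8) e / 8"
        using ex_digit_expansion[of 8 x] x by auto
      \<comment> \<open>Undo the packing: \<open>n\<close> zeros and a marker bit 1 at position
        \<open>n\<close> select the piece; afterwards each octal digit of \<open>e\<close> is split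
        into its remainder modulo 4, stored in \<open>c\<close>, and its top bit, stored in
        \<open>c'\<close> above the vertical bit.\<close>
      define c where "c = (\<lambda>k. if k \<le> n then 0 else e (k - n - 1) mod 4)"
      define c' where "c' = (\<lambda>k. if k < n then 0 else if k = n then 1
                                  else b (k - n - 1) + 2 * (e (k - n - 1) div 4))"
      have b1: "b k \<le> 1" for k using b by (rule bounded_digitsD)
      have "i mod 4 \<le> 3" for i :: nat using mod_less_divisor[of 4 i] by linarith
      then have "c \<in> bounded_digits 3" by (simp add: c_def bounded_digits_def)
      moreover have "c' k \<le> 3" for k
      proof -
        have "b i + 2 * (e i div 4) \<le> 3" for i using b1[of i] div_le_mono[OF bounded_digitsD[OF e(1), of i], of 4] by simp
        then show ?thesis by (auto simp: c'_def)
      qed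
      then have "c' \<in> bounded_digits 3" by (simp add: bounded_digits_def)
      moreover have "fold_code c c' = w"
      proof -
        have *: "b k = 0 \<or> b k = 1" for k using b1[of k] by linarith
        have bm: "b k mod 2 = b k" for k using *[of k] by auto
        have m: "(b k + 2 * (e k div 4)) mod 2 = b k" "(b k + 2 * (e k div 4)) div 2 = e k div 4" for k
          using *[of k] by auto
        have "fold_code c c' = piece_pt n (digit_sum (1/8) (\<lambda>k. c (k + n + 1) + 4 * (c' (k + n + 1) div 2)) / 8)
                (\<lambda>k. c' (k + n + 1) mod 2)"
          by (rule fold_code_eq) (auto simp: c'_def)
        also have "(\<lambda>k. c (k + n + 1) + 4 * (c' (k + n + 1) div 2)) = e"
          by (auto simp: c_def c'_def m)
        also have "(\<lambda>k. c' (k + n + 1) mod 2) = b"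
          by (simp add: c'_def bm)
        finally show ?thesis by (simp add: w e(2))
      qed
      ultimately show ?thesis using onto by metis
    qed
  qed
qed

lemma compact_cantor: "compact cantor"
proof -
  have "cantor = (\<lambda>p. pt (fst p) (snd p)) ` (digit_sum (1/8) ` bounded_digits 3 \<times> digit_sum (1/8) ` bounded_digits 3)"
    unfolding cantor_def by force
  moreover have "compact (digit_sum (1/8) ` bounded_digits 3)"
    by (rule compact_digit_sums) auto
  then have "compact (digit_sum (1/8) ` bounded_digits 3 \<times> digit_sum (1/8) ` bounded_digits 3)"
    by (intro compact_Times)
  then have "compact ((\<lambda>p. pt (fst p) (snd p)) ` (digit_sum (1/8) ` bounded_digits 3 \<times> digit_sum (1/8) ` bounded_digits 3))"
    by (rule compact_continuous_image[rotated]) (intro continuous_intros)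
  ultimately show ?thesis by simp
qed

lemma compact_comb: "compact comb"
proof -
  have "(1/2)-lipschitz_on cantor cantor_fold"
    by (rule lipschitz_onI) (use cantor_fold_lipschitz in auto)
  then show ?thesis
    unfolding cantor_fold_image[symmetric]
    by (intro compact_continuous_image compact_cantor lipschitz_on_continuous_on)
qed

section \<open>The iterated function system\<close>

lemma compact_K_set: "compact K_set"
  unfolding K_set_def by (intro compact_Un compact_cantor compact_comb)

text \<open>The Cantor set and the comb are at least 16 apart, so collapsing the comb to a point
  within 8 of all the images costs no more than the constant 1/2. This is how a map defined only on
  the Cantor set extends to \<open>K_set\<close>.\<close>

lemma contraction_glue:
  assumes lip: "\<And>a b. \<lbrakk>a \<in> cantor; b \<in> cantor\<rbrakk> \<Longrightarrow> dist (\<psi> a) (\<psi> b) \<le> 1/2 * dist a b"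
    and in_K: "\<And>a. a \<in> cantor \<Longrightarrow> \<psi> a \<in> K_set" and p: "p \<in> K_set"
    and near: "\<And>a. a \<in> cantor \<Longrightarrow> dist (\<psi> a) p \<le> 8"
  shows "contraction_on K_set (\<lambda>z. if z \<in> cantor then \<psi> z else p)"
  unfolding contraction_on_def
proof (intro conjI exI)
  show "(\<lambda>z. if z \<in> cantor then \<psi> z else p) \<in> K_set \<rightarrow> K_set" using in_K p by auto
  show "(1/2)-lipschitz_on K_set (\<lambda>z. if z \<in> cantor then \<psi> z else p)"
  proof (rule lipschitz_onI)
    fix a b assume "a \<in> K_set" "b \<in> K_set"
    moreover have "dist (\<psi> a) p \<le> 1/2 * dist a b" "dist p (\<psi> a) \<le> 1/2 * dist b a"
      if "a \<in> cantor" "b \<in> comb" for a b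
      using near[OF that(1)] cantor_comb_dist[OF that] by (simp_all add: dist_commute)
    ultimately show "dist (if a \<in> cantor then \<psi> a else p) (if b \<in> cantor then \<psi> b else p) \<le> 1/2 * dist a b"
      using lip[of a b] by (auto simp: K_set_def)
  qed simp
qed simp

definition cantor_map :: "nat \<Rightarrow> nat \<Rightarrow> real ^ 2 \<Rightarrow> real ^ 2" where
  "cantor_map i j z = pt (real i + z $ 1 / 8) (real j + z $ 2 / 8)"

lemma cantor_map_in:
  assumes "i \<le> 3" "j \<le> 3" "z \<in> cantor"
  shows "cantor_map i j z \<in> cantor"
proof -
  from assms(3) obtain c c' where c: "c \<in> bounded_digits 3" "c' \<in> bounded_digits 3"
     "z = pt (digit_sum (1/8) c) (digit_sum (1/8) c')" by (rule cantor_codeE)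
  have b: "case_nat i c \<in> bounded_digits 3" "case_nat j c' \<in> bounded_digits 3"
    using c assms by (auto simp: bounded_digits_def split: nat.split)
  then have "cantor_map i j z = pt (digit_sum (1/8) (case_nat i c)) (digit_sum (1/8) (case_nat j c'))"
    using digit_sum_Suc[of "1/8" "case_nat i c" 3] digit_sum_Suc[of "1/8" "case_nat j c'" 3]
    by (simp add: cantor_map_def c(3))
  then show ?thesis using b by (auto simp: cantor_def)
qed

lemma cantor_map_onto:
  assumes "z \<in> cantor"
  obtains i j w where "i \<le> 3" "j \<le> 3" "w \<in> cantor" "z = cantor_map i j w"
proof -
  from assms obtain c c' where c: "c \<in> bounded_digits 3" "c' \<in> bounded_digits 3"
     "z = pt (digit_sum (1/8) c) (digit_sum (1/8) c')" by (rule cantor_codeE)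
  show ?thesis
  proof (rule that[of "c 0" "c' 0" "pt (digit_sum (1/8) (\<lambda>k. c (Suc k))) (digit_sum (1/8) (\<lambda>k. c' (Suc k)))"])
    show "z = cantor_map (c 0) (c' 0)
       (pt (digit_sum (1/8) (\<lambda>k. c (Suc k))) (digit_sum (1/8) (\<lambda>k. c' (Suc k))))"
      using digit_sum_Suc[of "1/8" c 3] digit_sum_Suc[of "1/8" c' 3] c by (simp add: cantor_map_def)
  qed (use c in \<open>auto simp: cantor_def bounded_digits_def\<close>)
qed

lemma zero_in_cantor: "0 \<in> cantor"
proof -
  have "0 = pt (digit_sum (1/8) (\<lambda>_. 0)) (digit_sum (1/8) (\<lambda>_. 0))" by (simp add: pt_zero)
  then show ?thesis
    unfolding cantor_def by (intro image_eqI[of _ _ "(\<lambda>_. 0, \<lambda>_. 0)"]) (simp_all add: zero_digits)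
qed

lemma contraction_cantor_map:
  assumes "i \<le> 3" "j \<le> 3"
  shows "contraction_on K_set (\<lambda>z. if z \<in> cantor then cantor_map i j z else cantor_map i j 0)"
proof (rule contraction_glue)
  have d: "dist (cantor_map i j a) (cantor_map i j b) \<le> 1/4 * dist a b" for a b
    using dist_le_coords[of "cantor_map i j a" "cantor_map i j b"] coord_le_dist[of a 1 b] coord_le_dist[of a 2 b]
    by (simp add: cantor_map_def flip: diff_divide_distrib)
  show "dist (cantor_map i j a) (cantor_map i j b) \<le> 1/2 * dist a b" for a b
    using d[of a b] zero_le_dist[of a b] by linarith
  show "dist (cantor_map i j a) (cantor_map i j 0) \<le> 8" if "a \<in> cantor" for a
    using d[of a 0] dist_le_coords[of a 0] cantor_coords[OF that, of 1] cantor_coords[OF that, of 2] by simp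
qed (use assms cantor_map_in zero_in_cantor in \<open>auto simp: K_set_def\<close>)

lemma contraction_cantor_fold:
  "contraction_on K_set (\<lambda>z. if z \<in> cantor then cantor_fold z else apex)"
proof (rule contraction_glue)
  show "dist (cantor_fold a) apex \<le> 8" if "a \<in> cantor" for a
  proof -
    have "dist (cantor_fold a) (cantor_fold 0) \<le> 1/2 * dist a 0"
      using that zero_in_cantor by (rule cantor_fold_lipschitz)
    moreover have "cantor_fold 0 = apex"
    proof -
      have "cantor_code 0 = (\<lambda>_. 0, \<lambda>_. 0)"
        using cantor_code_pt[OF zero_digits zero_digits] by (simp add: pt_zero)
      then show ?thesis by (simp add: cantor_fold_def fold_code_zero)
    qed
    ultimately show ?thesis
      using dist_le_coords[of a 0] cantor_coords[OF that, of 1] cantor_coords[OF that, of 2] by simp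
  qed
qed (use cantor_fold_lipschitz cantor_fold_image in \<open>auto simp: K_set_def comb_def\<close>)

lemma ifs_attractor_K_set: "ifs_attractor K_set"
  unfolding ifs_attractor_def
proof (intro conjI exI)
  \<comment> \<open>Indices 1 to 16 encode a leading digit pair as \<open>4 * i + j + 1\<close>;
    index 17 is the fold onto the comb.\<close>
  define \<Psi> where "\<Psi> = (\<lambda>i::nat. if i = 17 then (\<lambda>z. if z \<in> cantor then cantor_fold z else apex)
    else (\<lambda>z. if z \<in> cantor then cantor_map ((i - 1) div 4) ((i - 1) mod 4) z
              else cantor_map ((i - 1) div 4) ((i - 1) mod 4) 0))"
  show "K_set \<noteq> {}" using zero_in_cantor by (auto simp: K_set_def)
  show contr: "\<forall>i\<in>{1..17}. contraction_on K_set (\<Psi> i)"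
  proof
    fix i :: nat assume "i \<in> {1..17}"
    then show "contraction_on K_set (\<Psi> i)"
      using contraction_cantor_fold contraction_cantor_map[of "(i - 1) div 4" "(i - 1) mod 4"]
      by (cases "i = 17") (auto simp: \<Psi>_def)
  qed
  show "K_set = (\<Union>i\<in>{1..17}. \<Psi> i ` K_set)"
  proof
    show "(\<Union>i\<in>{1..17}. \<Psi> i ` K_set) \<subseteq> K_set"
      using contr unfolding contraction_on_def by blast
    show "K_set \<subseteq> (\<Union>i\<in>{1..17}. \<Psi> i ` K_set)"
    proof
      fix z assume "z \<in> K_set"
      then consider "z \<in> cantor" | "z \<in> comb" by (auto simp: K_set_def)
      then show "z \<in> (\<Union>i\<in>{1..17}. \<Psi> i ` K_set)"
      proof cases
        case 1
        then obtain i j w where w: "i \<le> 3" "j \<le> 3" "w \<in> cantor" "z = cantor_map i j w"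
          by (rule cantor_map_onto)
        have "z = \<Psi> (4 * i + j + 1) w" using w by (simp add: \<Psi>_def)
        moreover have "4 * i + j + 1 \<in> {1..17}" using w by simp
        ultimately show ?thesis using w(3) by (auto simp: K_set_def)
      next
        case 2
        then obtain w where w: "w \<in> cantor" "z = cantor_fold w" using cantor_fold_image by blast
        then have "z = \<Psi> 17 w" by (simp add: \<Psi>_def)
        then show ?thesis using w(1) by (intro UN_I[of 17]) (auto simp: K_set_def)
      qed
    qed
  qed
qed (rule compact_K_set)


section \<open>Dimension estimates in the pieces\<close>

lemma hausdorff_null_singleton: "s > 0 \<Longrightarrow> hausdorff_measure s {x} = 0"
proof -
  assume s: "s > 0"
  show ?thesis
    unfolding hausdorff_measure_eq_0_iff[OF s]
  proof (intro allI impI)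
    fix \<epsilon> :: real assume "\<epsilon> > 0"
    then show "\<exists>U. {x} \<subseteq> (\<Union>i. U i) \<and> (\<forall>i. bounded (U i)) \<and>
       (\<Sum>i. ennreal (diameter (U i) powr s)) < ennreal \<epsilon>"
      using s by (intro finite_cover_powr_sum[where I = "{()}" and V = "\<lambda>_. {x}" and D = 0]) auto
  qed
qed

text \<open>Reading the binary digits of a parameter in [0,1] as a vertical code picks a segment,
  and \<open>A\<close> has a point on it. Heights alone separate these points well enough for
  \<open>hausdorff_dim_ge\<close>, wherever on the segments they lie. The prefix of \<open>m\<close>
  zeros allows a set that meets only the segments near the lowest one.\<close>

lemma piece_fibres_dim_ge:
  assumes fib: "\<And>b. \<lbrakk>b \<in> bounded_digits 1; \<And>k. k < m \<Longrightarrow> b k = 0\<rbrakk> \<Longrightarrow> \<exists>x. piece_pt n x b \<in> A"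
  shows "hausdorff_dim A \<ge> ereal (level_dim n)"
proof -
  define bin where "bin = (\<lambda>z. SOME d. d \<in> bounded_digits 1 \<and> z = digit_sum (1/2) d / 2)"
  have bin: "bin z \<in> bounded_digits 1" "z = digit_sum (1/2) (bin z) / 2" if "z \<in> {0..1}" for z
    using someI_ex[OF ex_digit_expansion[of 2 z]] that unfolding bin_def by auto
  \<comment> \<open>The binary digits are shifted behind the required zeros, which scales the
    heights by \<open>ratio n ^ m\<close>.\<close>
  define bm where "bm = (\<lambda>z k. if k < m then 0 else bin z (k - m))"
  have bm: "bm z \<in> bounded_digits 1" if "z \<in> {0..1}" for z
    using bounded_digitsD[OF bin(1)[OF that]] by (simp add: bm_def bounded_digits_def)
  note r = ratio_bounds[of n] and sc = piece_scale_bounds(1)[of n]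
  have ds: "digit_sum (ratio n) (bm z) = ratio n ^ m * digit_sum (ratio n) (bin z)" if "z \<in> {0..1}" for z
  proof -
    have "(\<lambda>k. bm z (k + m)) = bin z" by (simp add: bm_def)
    moreover have "(\<Sum>k<m. real (bm z k) * ratio n ^ k) = 0" by (simp add: bm_def)
    ultimately show ?thesis using digit_sum_split[of "ratio n" "bm z" 1 m] r bm[OF that] by simp
  qed
  have "\<forall>z. \<exists>x. z \<in> {0..1} \<longrightarrow> piece_pt n x (bm z) \<in> A"
    using fib bm by (auto simp: bm_def)
  then obtain X where X: "\<And>z. z \<in> {0..1} \<Longrightarrow> piece_pt n (X z) (bm z) \<in> A" by metis
  define a where "a = (\<lambda>z. piece_pt n (X z) (bm z))"
  \<comment> \<open>Undoes the scaling of the heights; the factor 2 compensates the separation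
    constant 1/2 below.\<close>
  define c where "c = 2 / (piece_scale n * ratio n ^ m)"
  have key: "\<bar>z - z'\<bar> \<le> (c * dist (a z) (a z')) powr level_dim n"
    if z: "z \<in> {0..1}" and z': "z' \<in> {0..1}" for z z'
  proof (cases "bin z = bin z'")
    case True
    then have "z = z'" using bin(2)[OF z] bin(2)[OF z'] by simp
    then show ?thesis by simp
  next
    case False
    then obtain j where j: "\<And>k. k < j \<Longrightarrow> bin z k = bin z' k" "bin z j \<noteq> bin z' j"
      by (rule first_difference) blast
    have "\<bar>digit_sum (1/2) (bin z) - digit_sum (1/2) (bin z')\<bar> \<le> real 1 / (1 - 1/2) * (1/2) ^ j"
      using bin(1)[OF z] bin(1)[OF z'] j(1) by (intro digit_sum_diff_le) auto
    then have "\<bar>z - z'\<bar> \<le> (1/2) ^ j"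
      by (subst bin(2)[OF z], subst bin(2)[OF z']) (simp flip: diff_divide_distrib)
    \<comment> \<open>By the Moran equation, binary length at depth \<open>j\<close> is the
      \<open>level_dim n\<close>-th power of vertical size at depth \<open>j\<close>.\<close>
    also have "\<dots> = (ratio n powr level_dim n) ^ j" by (simp add: ratio_powr)
    also have "\<dots> = (ratio n ^ j) powr level_dim n"
      using r by (simp add: powr_powr mult.commute flip: powr_realpow)
    also have "\<dots> \<le> (c * dist (a z) (a z')) powr level_dim n"
    proof (rule powr_mono2)
      have "1 - ratio n * (real 1 / (1 - ratio n)) \<ge> 1/2"
        using r by (simp add: field_simps)
      then have "1/2 * ratio n ^ j \<le> (1 - ratio n * (real 1 / (1 - ratio n))) * ratio n ^ j"
        using r by (intro mult_right_mono) auto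
      also have "\<dots> \<le> \<bar>digit_sum (ratio n) (bin z) - digit_sum (ratio n) (bin z')\<bar>"
        using bin(1)[OF z] bin(1)[OF z'] j r by (intro digit_sum_diff_ge) auto
      finally have *: "1/2 * ratio n ^ j \<le> \<bar>digit_sum (ratio n) (bin z) - digit_sum (ratio n) (bin z')\<bar>" .
      have "a z $ 2 - a z' $ 2 = piece_scale n * ratio n ^ m * (digit_sum (ratio n) (bin z) - digit_sum (ratio n) (bin z'))"
        by (simp add: a_def ds[OF z] ds[OF z'] algebra_simps)
      then have "piece_scale n * ratio n ^ m * \<bar>digit_sum (ratio n) (bin z) - digit_sum (ratio n) (bin z')\<bar> \<le> dist (a z) (a z')"
        using coord_le_dist[of "a z" 2 "a z'"] sc r by (simp add: abs_mult)
      then have "c * (piece_scale n * ratio n ^ m * \<bar>digit_sum (ratio n) (bin z) - digit_sum (ratio n) (bin z')\<bar>)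
          \<le> c * dist (a z) (a z')"
        using sc r by (intro mult_left_mono) (auto simp: c_def)
      moreover have "c * (piece_scale n * ratio n ^ m * x) = 2 * x" for x
        using sc r by (simp add: c_def)
      ultimately show "ratio n ^ j \<le> c * dist (a z) (a z')" using * by simp
    qed (use r level_dim_bounds[of n] in auto)
    finally show ?thesis .
  qed
  show ?thesis
    by (rule hausdorff_dim_ge[OF level_dim_bounds(1), of c a A])
      (use sc r X key in \<open>auto simp: c_def a_def\<close>)
qed

text \<open>Cells are given by a label \<open>J\<close> and \<open>m\<close> vertical bits. Within a
  cell heights differ by at most \<open>ratio n ^ m\<close>, and \<open>close\<close> then bounds
  the horizontal differences by \<open>2 * ratio n ^ m\<close>. Thus a set that is nearly a graph
  over the vertical coordinate for each label needs only about \<open>2 ^ m\<close> cells per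
  label.\<close>

lemma piece_prefix_cover:
  assumes A: "A \<subseteq> piece n" and I: "finite I" "J ` A \<subseteq> I" and s: "s > 0"
    and close: "\<And>z w. \<lbrakk>z \<in> A; w \<in> A; J z = J w\<rbrakk> \<Longrightarrow> \<bar>z $ 1 - w $ 1\<bar> \<le> \<bar>z $ 2 - w $ 2\<bar> + ratio n ^ m"
    and le: "real (card I) * 2 ^ m * (3 * ratio n ^ m) powr s < \<epsilon>"
  shows "\<exists>U :: nat \<Rightarrow> (real ^ 2) set. A \<subseteq> (\<Union>i. U i) \<and> (\<forall>i. bounded (U i)) \<and>
       (\<Sum>i. ennreal (diameter (U i) powr s)) < ennreal \<epsilon>"
proof -
  define L where "L = {xs :: nat list. set xs \<subseteq> {..1} \<and> length xs = m}"
  have L: "finite L" "card L = 2 ^ m"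
    unfolding L_def by (simp_all add: finite_lists_length_eq card_lists_length_eq numeral_2_eq_2)
  \<comment> \<open>The existential quantifier over codes lets any code of \<open>z\<close> place it
    in a cell, without choosing one.\<close>
  define V where "V = (\<lambda>(i, xs). {z \<in> A. J z = i \<and> (\<exists>x. \<exists>b \<in> bounded_digits 1. z = piece_pt n x b \<and> map b [0..<m] = xs)})"
  note r = ratio_bounds[of n] and sc = piece_scale_bounds[of n]
  show ?thesis
  proof (rule finite_cover_powr_sum[of "I \<times> L" A V "3 * ratio n ^ m" s \<epsilon>])
    show "A \<subseteq> (\<Union>i\<in>I \<times> L. V i)"
    proof
      fix z assume z: "z \<in> A"
      then obtain x b where b: "z = piece_pt n x b" "b \<in> bounded_digits 1"
        using A by (auto simp: piece_def)
      have "map b [0..<m] \<in> L" using bounded_digitsD[OF b(2)] by (auto simp: L_def)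
      moreover have "z \<in> V (J z, map b [0..<m])" using z b by (auto simp: V_def)
      moreover have "J z \<in> I" using z I by auto
      ultimately show "z \<in> (\<Union>i\<in>I \<times> L. V i)" by blast
    qed
    fix p z w assume "z \<in> V p" "w \<in> V p"
    then obtain x b y d where zw: "z \<in> A" "w \<in> A" "J z = J w"
      "z = piece_pt n x b" "w = piece_pt n y d" "b \<in> bounded_digits 1" "d \<in> bounded_digits 1"
      "map b [0..<m] = map d [0..<m]"
      unfolding V_def by (auto split: prod.splits)
    have eq: "b k = d k" if "k < m" for k using zw(8) that by simp
    have "\<bar>digit_sum (ratio n) b - digit_sum (ratio n) d\<bar> \<le> real 1 / (1 - ratio n) * ratio n ^ m"
      using zw eq r by (intro digit_sum_diff_le) auto
    also have "\<dots> \<le> 2 * ratio n ^ m" using r by (intro mult_right_mono) (auto simp: field_simps)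
    finally have "piece_scale n * \<bar>digit_sum (ratio n) b - digit_sum (ratio n) d\<bar> \<le> 1/512 * (2 * ratio n ^ m)"
      using sc r by (intro mult_mono) auto
    moreover have "\<bar>z $ 2 - w $ 2\<bar> = piece_scale n * \<bar>digit_sum (ratio n) b - digit_sum (ratio n) d\<bar>"
    proof -
      have "z $ 2 - w $ 2 = piece_scale n * (digit_sum (ratio n) b - digit_sum (ratio n) d)"
        by (simp add: zw(4,5) algebra_simps)
      then show ?thesis using sc by (simp add: abs_mult)
    qed
    moreover have "ratio n ^ m \<ge> 0" using r by simp
    ultimately have "\<bar>z $ 2 - w $ 2\<bar> \<le> ratio n ^ m" by linarith
    then show "dist z w \<le> 3 * ratio n ^ m"
      using dist_le_coords[of z w] close[OF zw(1-3)] by linarith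
  next
    show "real (card (I \<times> L)) * (3 * ratio n ^ m) powr s < \<epsilon>"
      using le L by (simp add: card_cartesian_product)
  qed (use I L s r in auto)
qed

text \<open>Above the critical exponent \<open>2 * ratio n powr s\<close> drops below 1, so the sum
  over the cells decays geometrically in \<open>m\<close>.\<close>

lemma prefix_count_small:
  assumes s: "s > level_dim n" and "\<epsilon> > 0"
  obtains m where "real N * 2 ^ m * (3 * ratio n ^ m) powr s < \<epsilon>"
proof -
  note r = ratio_bounds[of n]
  define \<theta> where "\<theta> = 2 * ratio n powr s"
  have "ratio n powr s < ratio n powr level_dim n" using s r by (intro powr_less_mono') auto
  then have th: "0 \<le> \<theta>" "\<theta> < 1" by (simp_all add: \<theta>_def ratio_powr)
  have c: "real N * 3 powr s \<ge> 0" by simp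
  obtain m where m: "\<theta> ^ m < \<epsilon> / (real N * 3 powr s + 1)"
    using real_arch_pow_inv[of "\<epsilon> / (real N * 3 powr s + 1)" \<theta>] th assms c by (auto simp: add_nonneg_pos)
  have "real N * 2 ^ m * (3 * ratio n ^ m) powr s = real N * 3 powr s * \<theta> ^ m"
    using r by (simp add: \<theta>_def powr_mult power_mult_distrib powr_powr mult_ac flip: powr_realpow)
  also have "\<dots> \<le> (real N * 3 powr s + 1) * \<theta> ^ m" using th by (intro mult_right_mono) auto
  also have "\<dots> < \<epsilon>" using m c by (simp add: field_simps add_nonneg_pos)
  finally show ?thesis by (rule that)
qed

text \<open>Points of a vertical line have no horizontal difference, so a single label serves in
  \<open>piece_prefix_cover\<close>.\<close>

lemma piece_slice_null:
  assumes "s > level_dim n"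
  shows "hausdorff_measure s (piece n \<inter> {z. z $ 1 = a}) = 0"
proof -
  have s: "s > 0" using assms level_dim_bounds[of n] by simp
  show ?thesis
    unfolding hausdorff_measure_eq_0_iff[OF s]
  proof (intro allI impI)
    fix \<epsilon> :: real assume "\<epsilon> > 0"
    then obtain m where m: "real 1 * 2 ^ m * (3 * ratio n ^ m) powr s < \<epsilon>"
      by (rule prefix_count_small[OF assms, of _ 1])
    show "\<exists>U. piece n \<inter> {z. z $ 1 = a} \<subseteq> (\<Union>i. U i) \<and> (\<forall>i. bounded (U i)) \<and>
       (\<Sum>i. ennreal (diameter (U i) powr s)) < ennreal \<epsilon>"
      by (rule piece_prefix_cover[where I = "{()}" and J = "\<lambda>_. ()" and m = m and n = n])
        (use s m ratio_bounds[of n] in auto)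
  qed
qed

text \<open>The exponent 1/3 itself is reached because each piece is strictly below it and null sets
  are closed under countable unions.\<close>

lemma comb_slice_null:
  assumes "s \<ge> 1/3"
  shows "hausdorff_measure s (comb \<inter> {z. z $ 1 = a}) = 0"
proof (rule hausdorff_null_subset)
  show "comb \<inter> {z. z $ 1 = a} \<subseteq> {apex} \<union> (\<Union>n. piece n \<inter> {z. z $ 1 = a})"
    by (auto simp: comb_def)
  show "hausdorff_measure s ({apex} \<union> (\<Union>n. piece n \<inter> {z. z $ 1 = a})) = 0"
  proof (intro hausdorff_null_Un hausdorff_null_UN hausdorff_null_singleton piece_slice_null)
    show "level_dim n < s" for n using level_dim_bounds(2)[of n] assms by linarith
  qed (use assms in auto)
qed (use assms in auto)


section \<open>The topological Hausdorff dimension of the attractor\<close>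

lemma negligible_cantor_coords: "negligible ((\<lambda>z. z $ i) ` cantor)"
proof (rule negligible_subset)
  show "negligible (digit_sum (1/8) ` bounded_digits 3)"
    by (rule negligible_digit_sums) auto
  show "(\<lambda>z. z $ i) ` cantor \<subseteq> digit_sum (1/8) ` bounded_digits 3"
    using exhaust_2[of i] by (auto simp: cantor_def)
qed

text \<open>Lets horizontal sides of rectangles miss \<open>K_set\<close> altogether. Vertical sides
  can only be made to miss the Cantor set, since the comb contains horizontal segments.\<close>

lemma negligible_K_set_snd: "negligible ((\<lambda>z. z $ 2) ` K_set)"
proof (rule negligible_subset)
  define E where "E = (\<lambda>n. (\<lambda>y. piece_scale n * (1 + y)) ` (digit_sum (ratio n) ` bounded_digits 1))"
  have "negligible (E n)" for n
  proof -
    have "negligible (digit_sum (ratio n) ` bounded_digits 1)"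
      using ratio_bounds[of n] by (intro negligible_digit_sums) auto
    then show ?thesis unfolding E_def
      by (intro negligible_differentiable_image_negligible) (auto intro!: derivative_intros)
  qed
  then show "negligible ((\<lambda>z. z $ 2) ` cantor \<union> {0} \<union> (\<Union>n. E n))"
    by (intro negligible_Un negligible_cantor_coords negligible_countable_Union negligible_sing) auto
  show "(\<lambda>z. z $ 2) ` K_set \<subseteq> (\<lambda>z. z $ 2) ` cantor \<union> {0} \<union> (\<Union>n. E n)"
    by (auto simp: K_set_def comb_def apex_def piece_def E_def)
qed

lemma ex_between_notin_negligible:
  fixes l u :: real
  assumes "negligible N" "l < u"
  obtains a where "l < a" "a < u" "a \<notin> N"
proof -
  have "\<not> {l<..<u} \<subseteq> N"
  proof
    assume "{l<..<u} \<subseteq> N"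
    then have "negligible {l<..<u}" using assms(1) negligible_subset by blast
    then show False using open_not_negligible[of "{l<..<u}"] assms(2) by auto
  qed
  then obtain a where "a \<in> {l<..<u}" "a \<notin> N" by blast
  then show ?thesis by (intro that) auto
qed

text \<open>\<open>U\<close> is cut out by a rectangle whose horizontal sides lie at heights not
  attained in \<open>K_set\<close> and whose vertical sides miss the Cantor set. The frontier is
  then contained in two vertical slices of the comb.\<close>

lemma K_set_small_frontier_base:
  assumes "openin (top_of_set K_set) W" "w \<in> W"
  obtains U where "openin (top_of_set K_set) U" "w \<in> U" "U \<subseteq> W"
    "hausdorff_dim (top_of_set K_set frontier_of U) \<le> ereal (1/3)"
proof -
  obtain T where T: "open T" "W = K_set \<inter> T" using assms(1) by (auto simp: openin_open)
  then obtain e where e: "e > 0" "ball w e \<subseteq> T" using assms(2) open_contains_ball by blast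
  let ?X = "(\<lambda>z. z $ 1) ` cantor" and ?Y = "(\<lambda>z. z $ 2) ` K_set"
  obtain a where a: "w $ 1 - e/2 < a" "a < w $ 1" "a \<notin> ?X"
    using ex_between_notin_negligible[OF negligible_cantor_coords[of 1], of "w $ 1 - e/2" "w $ 1"] e(1) by auto
  obtain b where b: "w $ 1 < b" "b < w $ 1 + e/2" "b \<notin> ?X"
    using ex_between_notin_negligible[OF negligible_cantor_coords[of 1], of "w $ 1" "w $ 1 + e/2"] e(1) by auto
  obtain c where c: "w $ 2 - e/2 < c" "c < w $ 2" "c \<notin> ?Y"
    using ex_between_notin_negligible[OF negligible_K_set_snd, of "w $ 2 - e/2" "w $ 2"] e(1) by auto
  obtain d where d: "w $ 2 < d" "d < w $ 2 + e/2" "d \<notin> ?Y"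
    using ex_between_notin_negligible[OF negligible_K_set_snd, of "w $ 2" "w $ 2 + e/2"] e(1) by auto
  define R where "R = {z :: real ^ 2. a < z $ 1 \<and> z $ 1 < b \<and> c < z $ 2 \<and> z $ 2 < d}"
  define R' where "R' = {z :: real ^ 2. a \<le> z $ 1 \<and> z $ 1 \<le> b \<and> c \<le> z $ 2 \<and> z $ 2 \<le> d}"
  have "open R"
    unfolding R_def by (intro open_Collect_conj open_Collect_less continuous_intros)
  have "closed R'"
    unfolding R'_def by (intro closed_Collect_conj closed_Collect_le continuous_intros)
  have wK: "w \<in> K_set" using assms(2) T by simp
  show ?thesis
  proof (rule that[of "K_set \<inter> R"])
    show op: "openin (top_of_set K_set) (K_set \<inter> R)" using \<open>open R\<close> by (auto simp: openin_open)
    show "w \<in> K_set \<inter> R" using a b c d wK by (auto simp: R_def)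
    have "R \<subseteq> ball w e"
    proof
      fix z assume "z \<in> R"
      then have "\<bar>w $ 1 - z $ 1\<bar> < e/2" "\<bar>w $ 2 - z $ 2\<bar> < e/2" 
        using a b c d unfolding R_def mem_Collect_eq by linarith+
      then show "z \<in> ball w e" using dist_le_coords[of w z] by simp
    qed
    then show "K_set \<inter> R \<subseteq> W" using T e by auto
    have fr: "top_of_set K_set frontier_of (K_set \<inter> R) \<subseteq> (comb \<inter> {z. z $ 1 = a}) \<union> (comb \<inter> {z. z $ 1 = b})"
    proof
      fix z assume z: "z \<in> top_of_set K_set frontier_of (K_set \<inter> R)"
      have "top_of_set K_set closure_of (K_set \<inter> R) \<subseteq> K_set \<inter> R'"
        using \<open>closed R'\<close> by (intro closure_of_minimal) (auto simp: closedin_closed R_def R'_def)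
      then have zK: "z \<in> K_set" "z \<in> R'" using z by (auto simp: frontier_of_def)
      moreover have "z \<notin> R"
        using z zK interior_of_openin[OF op] by (auto simp: frontier_of_def)
      moreover have "z $ 2 \<noteq> c" "z $ 2 \<noteq> d" using zK(1) c d by auto
      ultimately have ab: "z $ 1 = a \<or> z $ 1 = b" by (auto simp: R_def R'_def)
      then have "z \<notin> cantor" using a b by auto
      then show "z \<in> (comb \<inter> {z. z $ 1 = a}) \<union> (comb \<inter> {z. z $ 1 = b})"
        using zK ab by (auto simp: K_set_def)
    qed
    have "hausdorff_measure (1/3) (top_of_set K_set frontier_of (K_set \<inter> R)) = 0"
      by (rule hausdorff_null_subset[OF hausdorff_null_Un fr]) (auto intro: comb_slice_null)
    then show "hausdorff_dim (top_of_set K_set frontier_of (K_set \<inter> R)) \<le> ereal (1/3)"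
      by (rule hausdorff_dim_le) simp
  qed
qed

lemma continuous_on_piece_pt: "continuous_on S (\<lambda>x. piece_pt n x b)"
  unfolding piece_pt_def by (intro continuous_intros)

lemma piece_pt_in_K_set: "\<lbrakk>x \<in> {0..1}; b \<in> bounded_digits 1\<rbrakk> \<Longrightarrow> piece_pt n x b \<in> K_set"
  by (auto simp: K_set_def comb_def piece_def)

text \<open>A base set around the left end of the lowest segment of piece \<open>n\<close> contains
  the left ends of all segments with a long enough zero prefix. If it contains no right end, each of
  these connected segments must cross its frontier.\<close>

lemma K_set_base_frontier_dim:
  assumes base: "openin (top_of_set K_set) = arbitrary union_of (\<lambda>U. U \<in> \<B>)"
  shows "\<exists>U\<in>\<B>. hausdorff_dim (top_of_set K_set frontier_of U) \<ge> ereal (level_dim n)"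
proof -
  note r = ratio_bounds[of n] and sc = piece_scale_bounds(1)[of n]
  \<comment> \<open>The strict inequality excludes exactly the right ends \<open>x = 1\<close> from
    the segments of piece \<open>n\<close>.\<close>
  let ?T = "{z :: real ^ 2. z $ 1 < 20 + piece_scale n}"
  have "open ?T" by (intro open_Collect_less continuous_intros)
  then have "openin (top_of_set K_set) (K_set \<inter> ?T)" by (auto simp: openin_open)
  moreover have "piece_pt n 0 (\<lambda>_. 0) \<in> K_set \<inter> ?T"
    using piece_pt_in_K_set[of 0 "\<lambda>_. 0"] sc by simp
  ultimately obtain U where U: "U \<in> \<B>" "piece_pt n 0 (\<lambda>_. 0) \<in> U" "U \<subseteq> K_set \<inter> ?T"
    using base unfolding openin_topology_base_unique by metis
  have "openin (top_of_set K_set) U" using U(1) base unfolding openin_topology_base_unique by blast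
  then obtain e where e: "e > 0" "\<And>z. \<lbrakk>z \<in> K_set; dist z (piece_pt n 0 (\<lambda>_. 0)) < e\<rbrakk> \<Longrightarrow> z \<in> U"
    using U(2) unfolding openin_euclidean_subtopology_iff by blast
  obtain m where m: "ratio n ^ m < e / 2"
    using real_arch_pow_inv[of "e/2" "ratio n"] e r by auto
  have "\<exists>x. piece_pt n x b \<in> top_of_set K_set frontier_of U"
    if b: "b \<in> bounded_digits 1" "\<And>k. k < m \<Longrightarrow> b k = 0" for b
  proof -
    let ?S = "(\<lambda>x. piece_pt n x b) ` {0..1}"
    have "connected ?S" by (intro connected_continuous_image continuous_on_piece_pt) auto
    then have con: "connectedin (top_of_set K_set) ?S"
      using piece_pt_in_K_set b(1) by (auto simp: connectedin_subtopology)
    have "\<bar>digit_sum (ratio n) b - digit_sum (ratio n) (\<lambda>_. 0)\<bar> \<le> real 1 / (1 - ratio n) * ratio n ^ m"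
      using b r by (intro digit_sum_diff_le) auto
    also have "\<dots> \<le> 2 * ratio n ^ m" using r by (intro mult_right_mono) (auto simp: field_simps)
    also have "\<dots> < e" using m by simp
    finally have "\<bar>digit_sum (ratio n) b\<bar> < e" by simp
    then have "piece_scale n * \<bar>digit_sum (ratio n) b\<bar> < 1 * e"
      using piece_scale_bounds[of n] by (intro mult_le_less_imp_less) auto
    then have "dist (piece_pt n 0 b) (piece_pt n 0 (\<lambda>_. 0)) < e"
      using dist_le_coords[of "piece_pt n 0 b" "piece_pt n 0 (\<lambda>_. 0)"] sc by (simp add: distrib_left abs_mult)
    then have "piece_pt n 0 b \<in> U" using e(2) piece_pt_in_K_set[of 0 b] b by simp
    then have "?S \<inter> U \<noteq> {}" by (intro ex_in_conv[THEN iffD1] exI[of _ "piece_pt n 0 b"]) auto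
    moreover have "piece_pt n 1 b \<notin> U" using U(3) by auto
    moreover have "piece_pt n 1 b \<in> ?S" by (rule imageI) simp
    ultimately have "?S - U \<noteq> {}" "?S \<inter> U \<noteq> {}" by blast+
    then have "?S \<inter> top_of_set K_set frontier_of U \<noteq> {}"
      using con by (intro connectedin_Int_frontier_of)
    then show ?thesis by auto
  qed
  then have "hausdorff_dim (top_of_set K_set frontier_of U) \<ge> ereal (level_dim n)"
    by (rule piece_fibres_dim_ge)
  then show ?thesis using U(1) by blast
qed

lemma topological_hausdorff_dim_K_set: "topological_hausdorff_dim K_set = ereal (4/3)"
proof -
  let ?D = "{d. \<exists>\<B>. openin (top_of_set K_set) = arbitrary union_of (\<lambda>U. U \<in> \<B>) \<and>
                       (\<forall>U\<in>\<B>. hausdorff_dim (top_of_set K_set frontier_of U) \<le> d - 1)}"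
  have "K_set \<noteq> {}" using zero_in_cantor by (auto simp: K_set_def)
  then have "topological_hausdorff_dim K_set = Inf ?D" by (simp add: topological_hausdorff_dim_def)
  also have "\<dots> = ereal (4/3)"
  proof (rule antisym)
    let ?B = "{U. openin (top_of_set K_set) U \<and> hausdorff_dim (top_of_set K_set frontier_of U) \<le> ereal (1/3)}"
    have "openin (top_of_set K_set) = arbitrary union_of (\<lambda>U. U \<in> ?B)"
      unfolding openin_topology_base_unique using K_set_small_frontier_base by (auto, metis)
    moreover have "ereal (4/3) - 1 = ereal (1/3)" by (simp add: one_ereal_def)
    ultimately have "ereal (4/3) \<in> ?D" by (auto intro!: exI[of _ ?B])
    then show "Inf ?D \<le> ereal (4/3)" by (rule Inf_lower)
    show "ereal (4/3) \<le> Inf ?D"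
    proof (rule Inf_greatest)
      fix d assume "d \<in> ?D"
      \<comment> \<open>One \<open>d\<close> bounds the frontiers of a whole base, so it dominates
        every \<open>level_dim n\<close> and hence their limit.\<close>
      then have le: "ereal (level_dim n) \<le> d - 1" for n
        using K_set_base_frontier_dim[of _ n] order_trans by blast
      have "(\<lambda>n. ereal (level_dim n)) \<longlonglongrightarrow> ereal (1/3)"
        using level_dim_tendsto by simp
      then have "ereal (1/3) \<le> d - 1" by (rule LIMSEQ_le_const2) (use le in blast)
      then show "ereal (4/3) \<le> d" by (cases d) (auto simp: one_ereal_def)
    qed
  qed
  finally show ?thesis .
qed


section \<open>Generic properties of continuous functions\<close>

lemma mspace_C_space_iff:
  fixes K :: "'a::metric_space set"
  assumes "compact K"
  shows "f \<in> mspace (C_space K) \<longleftrightarrow> f \<in> extensional K \<and> continuous_on K f"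
  using compact_continuous_image[OF _ assms, of f] compact_imp_bounded by auto

lemma mdist_C_space_le_iff:
  fixes K :: "'a::metric_space set"
  assumes "K \<noteq> {}" "f \<in> mspace (C_space K)" "g \<in> mspace (C_space K)"
  shows "mdist (C_space K) f g \<le> a \<longleftrightarrow> (\<forall>x\<in>K. \<bar>f x - g x\<bar> \<le> a)"
proof -
  have "f \<in> mspace (funspace (topspace (top_of_set K)) euclidean_metric)"
    "g \<in> mspace (funspace (topspace (top_of_set K)) euclidean_metric)"
    using assms(2,3) by (auto simp: cfunspace_def)
  then show ?thesis
    using funspace_mdist_le[of f "topspace (top_of_set K)" euclidean_metric g a] assms(1)
    by (simp add: mdist_cfunspace_eq_mdist_funspace dist_real_def)
qed

text \<open>The functions satisfying \<open>Q\<close> have dense interior in the supremum metric.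
  Stated for arbitrary continuous functions, so that constructions need not produce extensional
  ones.\<close>

definition robustly_dense :: "'a::metric_space set \<Rightarrow> (('a \<Rightarrow> real) \<Rightarrow> bool) \<Rightarrow> bool" where
  "robustly_dense K Q \<longleftrightarrow> (\<forall>f e. continuous_on K f \<and> e > 0 \<longrightarrow>
     (\<exists>g. \<exists>\<eta>>0. continuous_on K g \<and> (\<forall>x\<in>K. \<bar>f x - g x\<bar> \<le> e) \<and>
        (\<forall>h. continuous_on K h \<and> (\<forall>x\<in>K. \<bar>g x - h x\<bar> \<le> \<eta>) \<longrightarrow> Q h)))"

lemma robustly_denseI:
  assumes "\<And>f e. \<lbrakk>continuous_on K f; e > 0\<rbrakk> \<Longrightarrow> \<exists>g. \<exists>\<eta>>0. continuous_on K g \<and> (\<forall>x\<in>K. \<bar>f x - g x\<bar> \<le> e) \<and>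
        (\<forall>h. continuous_on K h \<and> (\<forall>x\<in>K. \<bar>g x - h x\<bar> \<le> \<eta>) \<longrightarrow> Q h)"
  shows "robustly_dense K Q"
  using assms unfolding robustly_dense_def by blast

lemma nowhere_dense_in_C_space:
  fixes K :: "'a::metric_space set"
  assumes K: "compact K" "K \<noteq> {}" and Q: "robustly_dense K Q"
    and N: "N \<subseteq> mspace (C_space K)" "\<And>h. h \<in> N \<Longrightarrow> \<not> Q h"
  shows "nowhere_dense_in (mtopology_of (C_space K)) N"
proof -
  interpret M: Metric_space "mspace (C_space K)" "mdist (C_space K)"
    by (rule Metric_space_mspace_mdist)
  have False if "f \<in> M.mtopology interior_of (M.mtopology closure_of N)" for f
  proof -
    from that obtain e where e: "e > 0" "M.mball f e \<subseteq> M.mtopology closure_of N" and f: "f \<in> mspace (C_space K)"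
      unfolding M.in_interior_of_mball by blast
    have "continuous_on K f \<and> e/2 > 0" using e f mspace_C_space_iff[OF K(1)] by simp
    from Q[unfolded robustly_dense_def, rule_format, OF this]
    obtain g0 \<eta> where g0: "\<eta> > 0" "continuous_on K g0" "\<forall>x\<in>K. \<bar>f x - g0 x\<bar> \<le> e/2"
      "\<forall>h. continuous_on K h \<and> (\<forall>x\<in>K. \<bar>g0 x - h x\<bar> \<le> \<eta>) \<longrightarrow> Q h"
      by (elim exE conjE)
    \<comment> \<open>Restriction turns \<open>g0\<close> into an element of the function space
      without changing its values on \<open>K\<close>.\<close>
    define g where "g = restrict g0 K"
    have "continuous_on K g \<longleftrightarrow> continuous_on K g0"
      by (rule continuous_on_cong) (auto simp: g_def)
    then have g: "g \<in> mspace (C_space K)"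
      using g0(2) by (simp add: mspace_C_space_iff[OF K(1)] g_def del: mspace_cfunspace)
    have "\<forall>x\<in>K. \<bar>f x - g x\<bar> \<le> e/2" using g0(3) by (simp add: g_def)
    then have "mdist (C_space K) f g \<le> e/2" using mdist_C_space_le_iff[OF K(2) f g] by blast
    then have "g \<in> M.mball f e" using e f g by (simp add: M.mball_def del: mspace_cfunspace)
    then have "g \<in> M.mtopology closure_of N" using e by blast
    then obtain h where h: "h \<in> N" "h \<in> M.mball g \<eta>"
      using g0(1) unfolding M.metric_closure_of by blast
    have hM: "h \<in> mspace (C_space K)" using h N by blast
    have "mdist (C_space K) g h \<le> \<eta>" using h(2) by (simp add: M.mball_def del: mspace_cfunspace)
    then have "\<forall>x\<in>K. \<bar>g x - h x\<bar> \<le> \<eta>" using mdist_C_space_le_iff[OF K(2) g hM] by blast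
    then have "\<forall>x\<in>K. \<bar>g0 x - h x\<bar> \<le> \<eta>" by (simp add: g_def)
    moreover have "continuous_on K h" using hM mspace_C_space_iff[OF K(1)] by blast
    ultimately have "Q h" using g0(4) by blast
    then show False using N h by blast
  qed
  then show ?thesis
    using N(1) unfolding nowhere_dense_in_def mtopology_of_def M.topspace_mtopology by blast
qed

lemma generic_CI:
  fixes K :: "'a::metric_space set"
  assumes K: "compact K" "K \<noteq> {}" and \<Q>: "countable \<Q>" "\<And>Q. Q \<in> \<Q> \<Longrightarrow> robustly_dense K Q"
    and P: "\<And>h. \<lbrakk>continuous_on K h; \<And>Q. Q \<in> \<Q> \<Longrightarrow> Q h\<rbrakk> \<Longrightarrow> P h"
  shows "generic_C K P"
proof -
  \<comment> \<open>The conjunct \<open>\<not> P h\<close> makes the union equal to the complement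
    of \<open>P\<close>, since \<open>meagre_in\<close> asks for equality and not for
    inclusion.\<close>
  define \<F> where "\<F> = (\<lambda>Q. {h \<in> mspace (C_space K). \<not> Q h \<and> \<not> P h}) ` \<Q>"
  have "countable \<F>" using \<Q>(1) by (simp add: \<F>_def)
  moreover have "nowhere_dense_in (mtopology_of (C_space K)) N" if mem: "N \<in> \<F>" for N
  proof -
    obtain Q where Q: "N = {h \<in> mspace (C_space K). \<not> Q h \<and> \<not> P h}" "Q \<in> \<Q>"
      using mem unfolding \<F>_def by (rule imageE)
    show ?thesis
      by (rule nowhere_dense_in_C_space[OF K \<Q>(2)[OF Q(2)]]) (auto simp: Q(1) simp del: mspace_cfunspace)
  qed
  moreover have "mspace (C_space K) - {f \<in> mspace (C_space K). P f} = \<Union>\<F>"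
  proof
    show "mspace (C_space K) - {f \<in> mspace (C_space K). P f} \<subseteq> \<Union>\<F>"
    proof
      fix h assume h: "h \<in> mspace (C_space K) - {f \<in> mspace (C_space K). P f}"
      then have "continuous_on K h" "\<not> P h" using mspace_C_space_iff[OF K(1)] by blast+
      then obtain Q where "Q \<in> \<Q>" "\<not> Q h" using P by blast
      then show "h \<in> \<Union>\<F>" using h by (auto simp: \<F>_def simp del: mspace_cfunspace)
    qed
  qed (auto simp: \<F>_def simp del: mspace_cfunspace)
  ultimately show ?thesis
    unfolding generic_C_def comeagre_in_def meagre_in_def topspace_mtopology_of by blast
qed

section \<open>Gluing, Lipschitz approximation and separation of values\<close>

lemma continuous_on_separated:
  fixes A B :: "'a::metric_space set" and f g :: "'a \<Rightarrow> 'b::metric_space"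
  assumes f: "continuous_on A f" and g: "continuous_on B g" and "\<eta> > 0"
    and sep: "\<And>a b. \<lbrakk>a \<in> A; b \<in> B\<rbrakk> \<Longrightarrow> dist a b \<ge> \<eta>"
  shows "continuous_on (A \<union> B) (\<lambda>x. if x \<in> A then f x else g x)"
proof -
  have d: "A \<inter> B = {}" using sep \<open>\<eta> > 0\<close> by force
  show ?thesis
    unfolding continuous_on_iff
  proof (intro ballI allI impI)
    fix z and e :: real assume z: "z \<in> A \<union> B" and e: "e > 0"
    show "\<exists>d>0. \<forall>w\<in>A \<union> B. dist w z < d \<longrightarrow>
      dist (if w \<in> A then f w else g w) (if z \<in> A then f z else g z) < e"
    proof (cases "z \<in> A")
      case True
      then obtain \<delta> where "\<delta> > 0" "\<And>w. \<lbrakk>w \<in> A; dist w z < \<delta>\<rbrakk> \<Longrightarrow> dist (f w) (f z) < e"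
        using f e unfolding continuous_on_iff by blast
      then show ?thesis
        using True sep[of z] \<open>\<eta> > 0\<close> by (intro exI[of _ "min \<delta> \<eta>"]) (auto simp: dist_commute not_less[symmetric])
    next
      case False
      then have zB: "z \<in> B" using z by blast
      then obtain \<delta> where "\<delta> > 0" "\<And>w. \<lbrakk>w \<in> B; dist w z < \<delta>\<rbrakk> \<Longrightarrow> dist (g w) (g z) < e"
        using g e unfolding continuous_on_iff by blast
      then show ?thesis
        using False zB sep[of _ z] \<open>\<eta> > 0\<close> by (intro exI[of _ "min \<delta> \<eta>"]) (auto simp: not_less[symmetric])
    qed
  qed
qed

text \<open>The approximation is the infimal convolution of \<open>f\<close> with
  \<open>L * dist\<close>. With \<open>L * \<delta> \<ge> 2 * B\<close>, points at distance at least
  \<delta> cannot lower the infimum below \<open>f x\<close>, and nearer points lower it by at most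
  \<open>e\<close>.\<close>

lemma lipschitz_approximation:
  fixes f :: "'a::metric_space \<Rightarrow> real"
  assumes K: "compact K" "K \<noteq> {}" and f: "continuous_on K f" and e: "e > 0"
  obtains L g where "L > 0" "L-lipschitz_on K g" "\<forall>x\<in>K. \<bar>f x - g x\<bar> \<le> e"
proof -
  obtain B where B: "\<And>x. x \<in> K \<Longrightarrow> \<bar>f x\<bar> \<le> B"
    using compact_imp_bounded[OF compact_continuous_image[OF f K(1)]] by (auto simp: bounded_iff)
  have B0: "B \<ge> 0" using B K(2) by force
  from compact_uniformly_continuous[OF f K(1), unfolded uniformly_continuous_on_def, rule_format, OF e]
  obtain \<delta> where \<delta>: "\<delta> > 0" "\<forall>x\<in>K. \<forall>y\<in>K. dist y x < \<delta> \<longrightarrow> dist (f y) (f x) < e"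
    by (elim exE conjE)
  define L where "L = 2 * B / \<delta> + 1"
  have L: "L > 0" "L * \<delta> \<ge> 2 * B" using B0 \<delta>(1) by (auto simp: L_def add_nonneg_pos distrib_right)
  define g where "g = (\<lambda>x. INF y\<in>K. f y + L * dist x y)"
  have lower: "f x - e \<le> f y + L * dist x y" if "x \<in> K" "y \<in> K" for x y
  proof (cases "dist y x < \<delta>")
    case True
    have "L * dist x y \<ge> 0" using L by simp
    then show ?thesis using \<delta>(2) that True by (fastforce simp: dist_real_def)
  next
    case False
    then have "L * \<delta> \<le> L * dist x y" using L by (simp add: dist_commute)
    then show ?thesis using L B[OF that(1)] B[OF that(2)] e by linarith
  qed
  have bdd: "bdd_below ((\<lambda>y. f y + L * dist x y) ` K)" if "x \<in> K" for x
    using lower[OF that] by (intro bdd_belowI2) auto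
  have up: "g x \<le> f y + L * dist x y" if "x \<in> K" "y \<in> K" for x y
    unfolding g_def by (intro cINF_lower bdd that)
  show ?thesis
  proof (rule that[of L g])
    show "L > 0" by (rule L(1))
    show "L-lipschitz_on K g"
    proof (rule lipschitz_onI)
      have le: "g x - L * dist x x' \<le> g x'" if "x \<in> K" "x' \<in> K" for x x'
        unfolding g_def
      proof (rule cINF_greatest[OF K(2)])
        fix y assume y: "y \<in> K"
        have "L * dist x y \<le> L * (dist x x' + dist x' y)"
          using L by (intro mult_left_mono dist_triangle) auto
        then show "(INF y\<in>K. f y + L * dist x y) - L * dist x x' \<le> f y + L * dist x' y"
          using up[OF that(1) y] by (simp add: g_def distrib_left)
      qed
      fix x x' assume "x \<in> K" "x' \<in> K"
      then show "dist (g x) (g x') \<le> L * dist x x'"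
        using le[of x x'] le[of x' x] by (simp add: dist_real_def abs_le_iff dist_commute)
    qed (use L in simp)
    show "\<forall>x\<in>K. \<bar>f x - g x\<bar> \<le> e"
    proof
      fix x assume that: "x \<in> K"
      have "f x - e \<le> g x" unfolding g_def by (rule cINF_greatest[OF K(2)]) (rule lower[OF that])
      moreover have "g x \<le> f x" using up[OF that that] by simp
      ultimately show "\<bar>f x - g x\<bar> \<le> e" using e by linarith
    qed
  qed
qed

text \<open>\<open>arccos \<circ> cos\<close> is a triangle wave with slopes \<open>1\<close> and \<open>-1\<close>.\<close>

lemma abs_arccos_cos_diff:
  assumes "\<lfloor>x / pi\<rfloor> = \<lfloor>y / pi\<rfloor>"
  shows "\<bar>arccos (cos x) - arccos (cos y)\<bar> = \<bar>x - y\<bar>"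
proof -
  define j where "j = \<lfloor>x / pi\<rfloor>"
  have wave: "arccos (cos x) = (if even j then x - pi * of_int j else pi - (x - pi * of_int j))"
    if "\<lfloor>x / pi\<rfloor> = j" for x
  proof -
    define u where "u = x - pi * of_int j"
    have "of_int j \<le> x / pi" "x / pi < of_int j + 1" using that by linarith+
    then have u: "0 \<le> u" "u \<le> pi"
      by (simp_all add: u_def pos_le_divide_eq pos_divide_less_eq algebra_simps)
    have "cos x = (if even j then cos u else - cos u)"
      using cos_add[of u "pi * of_int j"] by (simp add: u_def)
    then show ?thesis using u by (simp add: arccos_minus arccos_cos u_def[symmetric])
  qed
  show ?thesis using wave[of x] wave[of y] assms by (auto simp: j_def)
qed

text \<open>Finitely many values are made distinct one at a time: an interval of admissible new
  values is infinite and cannot be exhausted by the old ones.\<close>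

lemma separated_perturbation:
  fixes v :: "'a \<Rightarrow> real"
  assumes "finite R" "e > 0"
  obtains v' \<sigma> where "\<sigma> > 0" "\<forall>a\<in>R. \<bar>v' a - v a\<bar> \<le> e"
    "\<forall>a\<in>R. \<forall>b\<in>R. a \<noteq> b \<longrightarrow> \<bar>v' a - v' b\<bar> \<ge> \<sigma>"
proof -
  have "\<exists>v' \<sigma>. \<sigma> > 0 \<and> (\<forall>a\<in>R. \<bar>v' a - v a\<bar> \<le> e) \<and> (\<forall>a\<in>R. \<forall>b\<in>R. a \<noteq> b \<longrightarrow> \<bar>v' a - v' b\<bar> \<ge> \<sigma>)"
    using assms(1)
  proof induction
    case empty
    then show ?case by (auto intro: exI[of _ 1])
  next
    case (insert r R)
    from insert.IH obtain v' \<sigma> where IH: "\<sigma> > 0" "\<forall>a\<in>R. \<bar>v' a - v a\<bar> \<le> e"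
      "\<forall>a\<in>R. \<forall>b\<in>R. a \<noteq> b \<longrightarrow> \<bar>v' a - v' b\<bar> \<ge> \<sigma>" by (elim exE conjE)
    have "infinite {v r..v r + e}" using assms(2) by (simp add: infinite_Icc)
    then have "\<not> {v r..v r + e} \<subseteq> v' ` R" using insert.hyps(1) finite_surj by blast
    then obtain t where t: "t \<in> {v r..v r + e}" "t \<notin> v' ` R" by blast
    obtain d where d: "d > 0" "\<And>x. \<lbrakk>x \<in> v' ` R; x \<noteq> t\<rbrakk> \<Longrightarrow> d \<le> dist t x"
      using finite_set_avoid[of "v' ` R" t] insert.hyps(1) by blast
    have d': "min \<sigma> d \<le> \<bar>t - v' a\<bar>" "min \<sigma> d \<le> \<bar>v' a - t\<bar>" if "a \<in> R" for a
      using d(2)[of "v' a"] t(2) that by (auto simp: dist_real_def abs_minus_commute intro: min.coboundedI2)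
    have IH': "min \<sigma> d \<le> \<bar>v' a - v' b\<bar>" if "a \<in> R" "b \<in> R" "a \<noteq> b" for a b
      using IH(3) that by (simp add: min.coboundedI1)
    show ?case
    proof (intro exI conjI)
      show "min \<sigma> d > 0" using IH(1) d(1) by simp
      show "\<forall>a\<in>insert r R. \<bar>(v'(r := t)) a - v a\<bar> \<le> e" using IH(2) t(1) by auto
      show "\<forall>a\<in>insert r R. \<forall>b\<in>insert r R. a \<noteq> b \<longrightarrow> min \<sigma> d \<le> \<bar>(v'(r := t)) a - (v'(r := t)) b\<bar>"
        using d' IH' insert.hyps(2) by auto
    qed
  qed
  then obtain v' \<sigma> where "\<sigma> > 0" "\<forall>a\<in>R. \<bar>v' a - v a\<bar> \<le> e"
    "\<forall>a\<in>R. \<forall>b\<in>R. a \<noteq> b \<longrightarrow> \<bar>v' a - v' b\<bar> \<ge> \<sigma>" by (elim exE conjE)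
  then show ?thesis by (rule that)
qed


section \<open>Generic functions on the attractor\<close>

text \<open>A finite-precision form of nullity of all levels on piece \<open>n\<close>; all
  \<open>k\<close> together give null levels. The exponent \<open>level_dim (Suc n)\<close> exceeds
  the critical \<open>level_dim n\<close> but stays below 1/3.\<close>

definition thin_levels :: "nat \<Rightarrow> nat \<Rightarrow> (real ^ 2 \<Rightarrow> real) \<Rightarrow> bool" where
  "thin_levels n k h \<longleftrightarrow> (\<forall>y. \<exists>U :: nat \<Rightarrow> (real ^ 2) set.
     {x \<in> piece n. h x = y} \<subseteq> (\<Union>i. U i) \<and> (\<forall>i. bounded (U i)) \<and>
     (\<Sum>i. ennreal (diameter (U i) powr level_dim (Suc n))) < ennreal (1 / (real k + 1)))"

text \<open>Strict signs at both ends of each segment, so that the intermediate value theorem puts a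
  point of the apex level on it. Asking for \<open>n \<ge> N\<close> with every \<open>N\<close>
  provides infinitely many such pieces.\<close>

definition crosses_apex_level :: "nat \<Rightarrow> (real ^ 2 \<Rightarrow> real) \<Rightarrow> bool" where
  "crosses_apex_level N h \<longleftrightarrow> (\<exists>n\<ge>N. \<forall>b\<in>bounded_digits 1.
     h (piece_pt n 0 b) < h apex \<and> h apex < h (piece_pt n 1 b))"

text \<open>For all \<open>k\<close> together this is injectivity on the Cantor set; a single
  \<open>k\<close> can be made stable under perturbation.\<close>

definition almost_injective :: "nat \<Rightarrow> (real ^ 2 \<Rightarrow> real) \<Rightarrow> bool" where
  "almost_injective k h \<longleftrightarrow> (\<forall>a\<in>cantor. \<forall>b\<in>cantor. h a = h b \<longrightarrow> dist a b < 1 / (real k + 1))"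

lemma K_set_nonempty: "K_set \<noteq> {}"
  using zero_in_cantor by (auto simp: K_set_def)

lemma piece_subset_K_set: "piece n \<subseteq> K_set"
  by (auto simp: K_set_def comb_def)

text \<open>
  Adding a steep triangle wave in the horizontal direction to a Lipschitz function leaves, in each
  tooth, levels that are graphs over the vertical coordinate up to a small error.
\<close>

lemma robustly_dense_thin_levels: "robustly_dense K_set (thin_levels n k)"
proof (rule robustly_denseI)
  fix f :: "real ^ 2 \<Rightarrow> real" and e :: real assume f: "continuous_on K_set f" and e: "e > 0"
  have e2: "e/2 > 0" using e by simp
  obtain L g0 where L: "L > 0" and g0: "L-lipschitz_on K_set g0" "\<forall>x\<in>K_set. \<bar>f x - g0 x\<bar> \<le> e/2"
    by (rule lipschitz_approximation[OF compact_K_set K_set_nonempty f e2])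
  \<comment> \<open>The frequency makes the wave of slope \<open>2 * L\<close> no higher than
    \<open>e/2\<close>.\<close>
  define M where "M = 4 * L * pi / e"
  have M: "M > 0" using L e by (simp add: M_def)
  define tri where "tri = (\<lambda>z :: real ^ 2. 2 * L * (arccos (cos (M * z $ 1)) / M))"
  have tri_bound: "0 \<le> tri z" "tri z \<le> e/2" for z
  proof -
    have a: "0 \<le> arccos (cos (M * z $ 1))" "arccos (cos (M * z $ 1)) \<le> pi"
      by (auto intro: arccos_lbound arccos_ubound)
    then show "0 \<le> tri z" using L M by (simp add: tri_def)
    have "tri z \<le> 2 * L * (pi / M)"
      unfolding tri_def using a L M by (intro mult_left_mono divide_right_mono) auto
    also have "\<dots> = e/2" using L e by (simp add: M_def)
    finally show "tri z \<le> e/2" .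
  qed
  define g where "g = (\<lambda>z. g0 z + tri z)"
  have "continuous_on K_set tri"
    unfolding tri_def using M by (intro continuous_intros) auto
  then have cont: "continuous_on K_set g"
    unfolding g_def using lipschitz_on_continuous_on[OF g0(1)] by (intro continuous_intros)
  have close: "\<bar>f x - g x\<bar> \<le> e" if "x \<in> K_set" for x
    using bspec[OF g0(2) that] tri_bound[of x] unfolding g_def by linarith
  \<comment> \<open>\<open>J\<close> numbers the monotone branches of the wave; as horizontal
    coordinates lie in [20,21], finitely many numbers occur.\<close>
  define J where "J = (\<lambda>z :: real ^ 2. \<lfloor>M * z $ 1 / pi\<rfloor>)"
  define I where "I = {\<lfloor>M * 20 / pi\<rfloor>..\<lfloor>M * 21 / pi\<rfloor>}"
  have JI: "J ` piece n \<subseteq> I"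
  proof
    fix i assume "i \<in> J ` piece n"
    then obtain z where z: "z \<in> piece n" "i = J z" by blast
    then have "20 \<le> z $ 1" "z $ 1 \<le> 21" using piece_bounds[of z n] piece_scale_bounds[of n] by linarith+
    then show "i \<in> I"
      unfolding z(2) I_def J_def using M by (auto intro!: floor_mono divide_right_mono)
  qed
  have lt: "level_dim n < level_dim (Suc n)" by (rule level_dim_mono) simp
  obtain m where m: "real (card I) * 2 ^ m * (3 * ratio n ^ m) powr level_dim (Suc n) < 1 / (real k + 1)"
    by (rule prefix_count_small[OF lt, of "1 / (real k + 1)" "card I"]) auto
  \<comment> \<open>Two perturbations by \<eta> shift the difference of values by
    \<open>L * ratio n ^ m\<close>, the error that \<open>piece_prefix_cover\<close> tolerates after
    division by \<open>L\<close>.\<close>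
  define \<eta> where "\<eta> = L * ratio n ^ m / 2"
  have eta: "\<eta> > 0" using L ratio_bounds[of n] by (simp add: \<eta>_def)
  have "thin_levels n k h" if h: "\<And>x. x \<in> K_set \<Longrightarrow> \<bar>g x - h x\<bar> \<le> \<eta>" for h
    unfolding thin_levels_def
  proof
    fix y
    show "\<exists>U. {x \<in> piece n. h x = y} \<subseteq> (\<Union>i. U i) \<and> (\<forall>i. bounded (U i)) \<and>
     (\<Sum>i. ennreal (diameter (U i) powr level_dim (Suc n))) < ennreal (1 / (real k + 1))"
    proof (rule piece_prefix_cover[where I = I and J = J and m = m and n = n])
      fix z w assume z: "z \<in> {x \<in> piece n. h x = y}" and w: "w \<in> {x \<in> piece n. h x = y}" and J: "J z = J w"
      have K: "z \<in> K_set" "w \<in> K_set" using z w piece_subset_K_set by auto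
      have "\<bar>g z - g w\<bar> \<le> 2 * \<eta>" using h[OF K(1)] h[OF K(2)] z w by auto
      moreover have "\<bar>g0 z - g0 w\<bar> \<le> L * (\<bar>z $ 1 - w $ 1\<bar> + \<bar>z $ 2 - w $ 2\<bar>)"
      proof -
        have "\<bar>g0 z - g0 w\<bar> \<le> L * dist z w"
          using lipschitz_onD[OF g0(1) K] by (simp add: dist_real_def)
        also have "\<dots> \<le> L * (\<bar>z $ 1 - w $ 1\<bar> + \<bar>z $ 2 - w $ 2\<bar>)"
          using L by (intro mult_left_mono dist_le_coords) auto
        finally show ?thesis .
      qed
      moreover have "\<bar>tri z - tri w\<bar> = 2 * L * \<bar>z $ 1 - w $ 1\<bar>"
      proof -
        have "tri z - tri w = (2 * L / M) * (arccos (cos (M * z $ 1)) - arccos (cos (M * w $ 1)))"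
          unfolding tri_def by (simp add: algebra_simps diff_divide_distrib)
        then have "\<bar>tri z - tri w\<bar> = (2 * L / M) * \<bar>M * z $ 1 - M * w $ 1\<bar>"
          using L M abs_arccos_cos_diff[of "M * z $ 1" "M * w $ 1"] J by (simp add: abs_mult J_def)
        also have "\<dots> = 2 * L * \<bar>z $ 1 - w $ 1\<bar>"
          using M by (simp add: abs_mult flip: right_diff_distrib)
        finally show ?thesis .
      qed
      \<comment> \<open>On one branch the wave has slope \<open>2 * L\<close>, of which the
        \<open>L\<close>-Lipschitz part \<open>g0\<close> can cancel at most half.\<close>
      ultimately have "2 * L * \<bar>z $ 1 - w $ 1\<bar> \<le> L * (\<bar>z $ 1 - w $ 1\<bar> + \<bar>z $ 2 - w $ 2\<bar>) + L * ratio n ^ m"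
        unfolding g_def \<eta>_def by linarith
      then have "L * \<bar>z $ 1 - w $ 1\<bar> \<le> L * (\<bar>z $ 2 - w $ 2\<bar> + ratio n ^ m)"
        by (simp add: algebra_simps)
      then show "\<bar>z $ 1 - w $ 1\<bar> \<le> \<bar>z $ 2 - w $ 2\<bar> + ratio n ^ m" using L by simp
    next
      show "J ` {x \<in> piece n. h x = y} \<subseteq> I" using JI by blast
    qed (use m level_dim_bounds in \<open>auto simp: I_def\<close>)
  qed
  then show "\<exists>g. \<exists>\<eta>>0. continuous_on K_set g \<and> (\<forall>x\<in>K_set. \<bar>f x - g x\<bar> \<le> e) \<and>
     (\<forall>h. continuous_on K_set h \<and> (\<forall>x\<in>K_set. \<bar>g x - h x\<bar> \<le> \<eta>) \<longrightarrow> thin_levels n k h)"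
    using cont close eta by blast
qed

text \<open>Piece \<open>n\<close> lies between the heights \<open>piece_scale n\<close> and
  \<open>15/7 * piece_scale n\<close>, and consecutive scales differ by the factor 8. The gap allows
  a function to be changed on one piece alone.\<close>

lemma piece_separated:
  assumes z: "z \<in> piece n" and w: "w \<in> K_set - piece n"
  shows "dist z w \<ge> piece_scale n / 2"
proof -
  note b = piece_bounds[OF z] and sc = piece_scale_bounds[of n]
  have zc: "z \<in> comb" using z by (auto simp: comb_def)
  from w consider "w \<in> cantor" | "w = apex" | m where "w \<in> piece m" "m \<noteq> n"
    by (auto simp: K_set_def comb_def)
  then show ?thesis
  proof cases
    case 1
    then show ?thesis using cantor_comb_dist[OF 1 zc] sc by (simp add: dist_commute)
  next
    case 2
    then show ?thesis using coord_le_dist[of z 2 w] b sc by (simp add: apex_def)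
  next
    case (3 m)
    note b' = piece_bounds[OF 3(1)]
    show ?thesis
    proof (cases "m < n")
      case True
      then have "piece_scale n \<le> piece_scale (m + 1)" by (intro piece_scale_mono) simp
      then have "8 * piece_scale n \<le> piece_scale m" using piece_scale_add[of m 1] by simp
      then show ?thesis using coord_le_dist[of z 2 w] b b' by linarith
    next
      case False
      then have "piece_scale m \<le> piece_scale (n + 1)" using 3(2) by (intro piece_scale_mono) simp
      then have "8 * piece_scale m \<le> piece_scale n" using piece_scale_add[of n 1] by simp
      then show ?thesis using coord_le_dist[of z 2 w] b b' by linarith
    qed
  qed
qed

lemma apex_in_K_set: "apex \<in> K_set"
  by (simp add: K_set_def comb_def)

lemma apex_notin_piece: "apex \<notin> piece n"
  using piece_bounds(3)[of apex n] piece_scale_bounds(1)[of n] by (auto simp: apex_def)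

lemma pieces_near_apex:
  assumes "\<delta> > 0"
  obtains N where "\<And>n z. \<lbrakk>n \<ge> N; z \<in> piece n\<rbrakk> \<Longrightarrow> dist z apex < \<delta>"
proof -
  obtain N where N: "(1/8::real) ^ N < \<delta>" using real_arch_pow_inv[of \<delta> "1/8"] assms by auto
  have sN: "piece_scale N \<le> (1/8) ^ N / 512" by (simp add: piece_scale_def power_add power3_eq_cube)
  show ?thesis
  proof (rule that)
    fix n z assume "n \<ge> N" "z \<in> piece n"
    then have "dist z apex \<le> 22/7 * piece_scale N"
      using dist_le_coords[of z apex] piece_bounds[of z n] piece_scale_mono[of N n] piece_scale_bounds(1)[of n]
      by (simp add: apex_def)
    then show "dist z apex < \<delta>" using sN N piece_scale_bounds(1)[of N] by linarith
  qed
qed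

text \<open>Close to the apex \<open>f\<close> varies by less than \<open>e/2\<close>. There, on a
  single piece, it is replaced by an affine function of the horizontal coordinate from
  \<open>f apex - e/2\<close> to \<open>f apex + e/2\<close>. These margins survive perturbations by
  \<open>e/8\<close> at the ends and at the apex.\<close>

lemma robustly_dense_crosses_apex_level: "robustly_dense K_set (crosses_apex_level N)"
proof (rule robustly_denseI)
  fix f :: "real ^ 2 \<Rightarrow> real" and e :: real assume f: "continuous_on K_set f" and e: "e > 0"
  have "e/2 > 0" using e by simp
  then obtain \<delta> where \<delta>: "\<delta> > 0" "\<And>x. \<lbrakk>x \<in> K_set; dist x apex < \<delta>\<rbrakk> \<Longrightarrow> dist (f x) (f apex) < e/2"
    using f apex_in_K_set unfolding continuous_on_iff by blast
  obtain N' where N': "\<And>n z. \<lbrakk>n \<ge> N'; z \<in> piece n\<rbrakk> \<Longrightarrow> dist z apex < \<delta>"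
    using pieces_near_apex[OF \<delta>(1)] by blast
  define n where "n = max N N'"
  note sc = piece_scale_bounds[of n]
  define q where "q = (\<lambda>z :: real ^ 2. f apex + e/2 * (2 * ((z $ 1 - 20) / piece_scale n) - 1))"
  define g where "g = (\<lambda>z. if z \<in> piece n then q z else f z)"
  have "continuous_on (piece n \<union> (K_set - piece n)) g"
    unfolding g_def
  proof (rule continuous_on_separated)
    show "continuous_on (piece n) q" unfolding q_def using sc by (intro continuous_intros) auto
    show "continuous_on (K_set - piece n) f" using f by (rule continuous_on_subset) auto
    show "piece_scale n / 2 > 0" using sc by simp
  qed (rule piece_separated)
  moreover have "piece n \<union> (K_set - piece n) = K_set" using piece_subset_K_set by blast
  ultimately have cont: "continuous_on K_set g" by simp
  have close: "\<bar>f x - g x\<bar> \<le> e" if x: "x \<in> K_set" for x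
  proof (cases "x \<in> piece n")
    case True
    have "0 \<le> (x $ 1 - 20) / piece_scale n" "(x $ 1 - 20) / piece_scale n \<le> 1"
      using piece_bounds[OF True] sc by auto
    then have "\<bar>2 * ((x $ 1 - 20) / piece_scale n) - 1\<bar> \<le> 1" by linarith
    then have "\<bar>e/2 * (2 * ((x $ 1 - 20) / piece_scale n) - 1)\<bar> \<le> e/2 * 1"
      unfolding abs_mult using e by (intro mult_mono) auto
    then have "\<bar>g x - f apex\<bar> \<le> e/2 * 1"
      using True by (simp only: g_def q_def if_True add_diff_cancel_left')
    moreover have "\<bar>f x - f apex\<bar> < e/2"
      using \<delta>(2)[OF x N'[OF _ True]] by (simp add: n_def dist_real_def)
    ultimately show ?thesis by linarith
  qed (use e in \<open>simp add: g_def\<close>)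
  have "crosses_apex_level N h" if h: "\<And>x. x \<in> K_set \<Longrightarrow> \<bar>g x - h x\<bar> \<le> e/8" for h
    unfolding crosses_apex_level_def
  proof (intro exI[of _ n] conjI ballI)
    show "n \<ge> N" by (simp add: n_def)
    fix b assume b: "b \<in> bounded_digits 1"
    have p: "piece_pt n 0 b \<in> piece n" "piece_pt n 1 b \<in> piece n" using b by (force simp: piece_def)+
    have "g apex = f apex" "g (piece_pt n 0 b) = f apex - e/2" "g (piece_pt n 1 b) = f apex + e/2"
      using p sc apex_notin_piece by (simp_all add: g_def q_def)
    moreover have "piece_pt n 0 b \<in> K_set" "piece_pt n 1 b \<in> K_set" using p piece_subset_K_set by blast+
    ultimately show "h (piece_pt n 0 b) < h apex" "h apex < h (piece_pt n 1 b)"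
      using h[OF apex_in_K_set] h[of "piece_pt n 0 b"] h[of "piece_pt n 1 b"] e by linarith+
  qed
  moreover have "e/8 > 0" using e by simp
  ultimately show "\<exists>g. \<exists>\<eta>>0. continuous_on K_set g \<and> (\<forall>x\<in>K_set. \<bar>f x - g x\<bar> \<le> e) \<and>
     (\<forall>h. continuous_on K_set h \<and> (\<forall>x\<in>K_set. \<bar>g x - h x\<bar> \<le> \<eta>) \<longrightarrow> crosses_apex_level N h)"
    using cont close by blast
qed

text \<open>On the Cantor set \<open>f\<close> is replaced by a function constant on small cells,
  with separated values on different cells. Points with equal values after a small perturbation must
  then share a cell.\<close>

lemma robustly_dense_almost_injective: "robustly_dense K_set (almost_injective k)"
proof (rule robustly_denseI)
  fix f :: "real ^ 2 \<Rightarrow> real" and e :: real assume f: "continuous_on K_set f" and e: "e > 0"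
  have "e/2 > 0" using e by simp
  from compact_uniformly_continuous[OF f compact_K_set, unfolded uniformly_continuous_on_def, rule_format, OF this]
  obtain \<delta> where \<delta>: "\<delta> > 0" "\<forall>x\<in>K_set. \<forall>y\<in>K_set. dist y x < \<delta> \<longrightarrow> dist (f y) (f x) < e/2"
    by (elim exE conjE)
  define \<delta>' where "\<delta>' = min \<delta> (1 / (real k + 1))"
  have "\<delta>' > 0" using \<delta>(1) by (simp add: \<delta>'_def)
  then obtain r :: "real ^ 2 \<Rightarrow> (nat \<times> nat) list" and \<eta>0 where r: "\<eta>0 > 0" "finite (r ` cantor)"
    "\<And>a b. \<lbrakk>a \<in> cantor; b \<in> cantor; dist a b < \<eta>0\<rbrakk> \<Longrightarrow> r a = r b"
    "\<And>a b. \<lbrakk>a \<in> cantor; b \<in> cantor; r a = r b\<rbrakk> \<Longrightarrow> dist a b < \<delta>'"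
    by (rule cantor_zero_dimensional) blast
  define c where "c = (\<lambda>t. SOME a. a \<in> cantor \<and> r a = t)"
  have c: "c (r a) \<in> cantor" "r (c (r a)) = r a" if "a \<in> cantor" for a
    using someI_ex[of "\<lambda>a'. a' \<in> cantor \<and> r a' = r a"] that unfolding c_def by blast+
  obtain v \<sigma> where v: "\<sigma> > 0" "\<forall>t\<in>r ` cantor. \<bar>v t - f (c t)\<bar> \<le> e/2"
    "\<forall>t\<in>r ` cantor. \<forall>u\<in>r ` cantor. t \<noteq> u \<longrightarrow> \<bar>v t - v u\<bar> \<ge> \<sigma>"
    by (rule separated_perturbation[OF r(2) \<open>e/2 > 0\<close>, of "\<lambda>t. f (c t)"])
  define g where "g = (\<lambda>z. if z \<in> cantor then v (r z) else f z)"
  have "continuous_on (cantor \<union> comb) g"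
    unfolding g_def
  proof (rule continuous_on_separated)
    show "continuous_on cantor (\<lambda>z. v (r z))"
      unfolding continuous_on_iff using r(1,3) by (metis dist_self)
    show "continuous_on comb f" using f by (rule continuous_on_subset) (auto simp: K_set_def)
    show "(16::real) > 0" by simp
  qed (rule cantor_comb_dist)
  then have cont: "continuous_on K_set g" by (simp add: K_set_def)
  have close: "\<bar>f x - g x\<bar> \<le> e" if x: "x \<in> K_set" for x
  proof (cases "x \<in> cantor")
    case True
    have "dist (c (r x)) x < \<delta>" using r(4)[of "c (r x)" x] c[OF True] True by (simp add: \<delta>'_def)
    then have "\<bar>f (c (r x)) - f x\<bar> < e/2"
      using \<delta>(2) x c(1)[OF True] by (auto simp: K_set_def dist_real_def)
    moreover have "\<bar>v (r x) - f (c (r x))\<bar> \<le> e/2" using v(2) True by blast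
    moreover have "g x = v (r x)" using True by (simp add: g_def)
    ultimately show ?thesis by linarith
  qed (use e in \<open>simp add: g_def\<close>)
  \<comment> \<open>Two errors of \<sigma>/3 stay below the separation \<sigma> of the cell
    values.\<close>
  have "almost_injective k h" if h: "\<And>x. x \<in> K_set \<Longrightarrow> \<bar>g x - h x\<bar> \<le> \<sigma>/3" for h
    unfolding almost_injective_def
  proof (intro ballI impI)
    fix a b assume ab: "a \<in> cantor" "b \<in> cantor" "h a = h b"
    then have "a \<in> K_set" "b \<in> K_set" "g a = v (r a)" "g b = v (r b)"
      by (simp_all add: K_set_def g_def)
    then have "\<bar>v (r a) - v (r b)\<bar> \<le> 2 * (\<sigma>/3)"
      using h[of a] h[of b] ab(3) by linarith
    then have "r a = r b" using v(1) v(3) ab by force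
    then show "dist a b < 1 / (real k + 1)" using r(4)[OF ab(1,2)] by (simp add: \<delta>'_def)
  qed
  moreover have "\<sigma>/3 > 0" using v by simp
  ultimately show "\<exists>g. \<exists>\<eta>>0. continuous_on K_set g \<and> (\<forall>x\<in>K_set. \<bar>f x - g x\<bar> \<le> e) \<and>
     (\<forall>h. continuous_on K_set h \<and> (\<forall>x\<in>K_set. \<bar>g x - h x\<bar> \<le> \<eta>) \<longrightarrow> almost_injective k h)"
    using cont close by blast
qed

section \<open>Level sets of a generic function\<close>

lemma thin_levels_null:
  assumes "\<And>k. thin_levels n k h"
  shows "hausdorff_measure (level_dim (Suc n)) {x \<in> piece n. h x = y} = 0"
  unfolding hausdorff_measure_eq_0_iff[OF level_dim_bounds(1)]
proof (intro allI impI)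
  fix \<epsilon> :: real assume "\<epsilon> > 0"
  then obtain k where k: "1 / (real k + 1) < \<epsilon>"
    using reals_Archimedean[of \<epsilon>] by (auto simp: inverse_eq_divide add.commute)
  obtain U :: "nat \<Rightarrow> (real ^ 2) set" where U: "{x \<in> piece n. h x = y} \<subseteq> (\<Union>i. U i)" "\<forall>i. bounded (U i)"
    "(\<Sum>i. ennreal (diameter (U i) powr level_dim (Suc n))) < ennreal (1 / (real k + 1))"
    using assms[of k] unfolding thin_levels_def by blast
  note U(3)
  also have "ennreal (1 / (real k + 1)) \<le> ennreal \<epsilon>" using k by (intro ennreal_leI) simp
  finally show "\<exists>U. {x \<in> piece n. h x = y} \<subseteq> (\<Union>i. U i) \<and> (\<forall>i. bounded (U i)) \<and>
     (\<Sum>i. ennreal (diameter (U i) powr level_dim (Suc n))) < ennreal \<epsilon>"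
    using U by blast
qed

lemma almost_injective_null:
  assumes h: "\<And>k. almost_injective k h" and s: "s > 0"
  shows "hausdorff_measure s {x \<in> cantor. h x = y} = 0"
proof -
  have "a = b" if "a \<in> cantor" "b \<in> cantor" "h a = h b" for a b
  proof (rule ccontr)
    assume "a \<noteq> b"
    then obtain k where "1 / (real k + 1) < dist a b"
      using reals_Archimedean[of "dist a b"] by (auto simp: inverse_eq_divide add.commute)
    then show False using h[of k] that unfolding almost_injective_def by fastforce
  qed
  then obtain x where "{x \<in> cantor. h x = y} \<subseteq> {x}" by blast
  then show ?thesis using hausdorff_null_subset[OF hausdorff_null_singleton[OF s]] s by blast
qed

text \<open>Above, every piece is null at an exponent below 1/3, so the countable union is null at
  1/3. Below, a crossed piece has a point of the level on every segment, so
  \<open>piece_fibres_dim_ge\<close> applies with \<open>m = 0\<close>, and crossed pieces occur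
  arbitrarily far out.\<close>

lemma apex_level_dim:
  assumes h: "continuous_on K_set h" and thin: "\<And>n k. thin_levels n k h"
    and inj: "\<And>k. almost_injective k h" and cross: "\<And>N. crosses_apex_level N h"
  shows "hausdorff_dim {x \<in> K_set. h x = h apex} = ereal (1/3)" (is "hausdorff_dim ?A = _")
proof (rule antisym)
  have "hausdorff_measure (1/3) ({x \<in> cantor. h x = h apex} \<union> ({apex} \<union> (\<Union>n. {x \<in> piece n. h x = h apex}))) = 0"
  proof (intro hausdorff_null_Un hausdorff_null_UN hausdorff_null_singleton almost_injective_null inj)
    show "hausdorff_measure (1/3) {x \<in> piece n. h x = h apex} = 0" for n
      by (rule hausdorff_null_mono_exponent[OF thin_levels_null[OF thin]])
        (use level_dim_bounds[of "Suc n"] in auto)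
  qed auto
  then have "hausdorff_measure (1/3) ?A = 0"
    by (rule hausdorff_null_subset) (auto simp: K_set_def comb_def)
  then show "hausdorff_dim ?A \<le> ereal (1/3)" by (rule hausdorff_dim_le) simp
  have le: "ereal (level_dim N) \<le> hausdorff_dim ?A" for N
  proof -
    obtain n where n: "n \<ge> N" "\<And>b. b \<in> bounded_digits 1 \<Longrightarrow> h (piece_pt n 0 b) < h apex \<and> h apex < h (piece_pt n 1 b)"
      using cross[of N] unfolding crosses_apex_level_def by blast
    have "\<exists>x. piece_pt n x b \<in> ?A" if b: "b \<in> bounded_digits 1" for b
    proof -
      have "continuous_on {0..1} (\<lambda>x. h (piece_pt n x b))"
        by (rule continuous_on_compose2[OF h continuous_on_piece_pt]) (use piece_pt_in_K_set b in auto)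
      then obtain x where "0 \<le> x" "x \<le> 1" "h (piece_pt n x b) = h apex"
        using IVT'[of "\<lambda>x. h (piece_pt n x b)" 0 "h apex" 1] n(2)[OF b] by auto
      then show ?thesis using piece_pt_in_K_set[of x b n] b by auto
    qed
    then have "ereal (level_dim n) \<le> hausdorff_dim ?A"
      by (intro piece_fibres_dim_ge[where m = 0])
    moreover have "level_dim N \<le> level_dim n"
      using n(1) level_dim_mono[of N n] by (cases "N = n") auto
    ultimately show ?thesis by (meson ereal_less_eq(3) order_trans)
  qed
  have "(\<lambda>n. ereal (level_dim n)) \<longlonglongrightarrow> ereal (1/3)"
    using level_dim_tendsto by simp
  then show "ereal (1/3) \<le> hausdorff_dim ?A"
    by (rule LIMSEQ_le_const2) (use le in blast)
qed

text \<open>By continuity at the apex the level misses all pieces from some \<open>N\<close> on. The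
  same \<open>N\<close> gives the exponent: for \<open>n < N\<close> the levels on piece
  \<open>n\<close> are null at \<open>level_dim (Suc n)\<close>, which is at most
  \<open>level_dim N\<close> and hence bounded away from 1/3.\<close>

lemma other_level_dim:
  assumes h: "continuous_on K_set h" and thin: "\<And>n k. thin_levels n k h"
    and inj: "\<And>k. almost_injective k h" and y: "y \<noteq> h apex"
  shows "hausdorff_dim {x \<in> K_set. h x = y} < ereal (1/3)" (is "hausdorff_dim ?A < _")
proof -
  have "\<bar>y - h apex\<bar> > 0" using y by simp
  then obtain \<delta> where \<delta>: "\<delta> > 0" "\<And>x. \<lbrakk>x \<in> K_set; dist x apex < \<delta>\<rbrakk> \<Longrightarrow> dist (h x) (h apex) < \<bar>y - h apex\<bar>"
    using h apex_in_K_set unfolding continuous_on_iff by blast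
  obtain N where N: "\<And>n z. \<lbrakk>n \<ge> N; z \<in> piece n\<rbrakk> \<Longrightarrow> dist z apex < \<delta>"
    using pieces_near_apex[OF \<delta>(1)] by blast
  define F where "F = (\<lambda>n. if n < N then {x \<in> piece n. h x = y} else {})"
  have sub: "?A \<subseteq> {x \<in> cantor. h x = y} \<union> (\<Union>n. F n)"
  proof
    fix x assume x: "x \<in> ?A"
    then consider "x \<in> cantor" | "x = apex" | n where "x \<in> piece n" by (auto simp: K_set_def comb_def)
    then show "x \<in> {x \<in> cantor. h x = y} \<union> (\<Union>n. F n)"
    proof cases
      case (3 n)
      have "n < N"
      proof (rule ccontr)
        assume "\<not> n < N"
        then have "dist (h x) (h apex) < \<bar>y - h apex\<bar>" using N[of n x] 3 x by (intro \<delta>(2)) auto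
        then show False using x by (simp add: dist_real_def)
      qed
      then have "x \<in> F n" using 3 x by (simp add: F_def)
      then show ?thesis by blast
    qed (use x y in auto)
  qed
  have null: "hausdorff_measure (level_dim N) (F n) = 0" for n
  proof (cases "n < N")
    case True
    then have "level_dim (Suc n) \<le> level_dim N"
      using level_dim_mono[of "Suc n" N] by (cases "Suc n = N") auto
    then show ?thesis
      using True hausdorff_null_mono_exponent[OF thin_levels_null[OF thin], of n "level_dim N" y]
        level_dim_bounds[of N] level_dim_bounds[of "Suc n"] by (simp add: F_def)
  qed (simp add: F_def hausdorff_measure_empty level_dim_bounds)
  have "hausdorff_measure (level_dim N) ?A = 0"
    using level_dim_bounds(1)[of N]
    by (intro hausdorff_null_subset[OF _ sub] hausdorff_null_Un hausdorff_null_UN null almost_injective_null inj)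
  then have "hausdorff_dim ?A \<le> ereal (level_dim N)"
    using level_dim_bounds(1)[of N] by (intro hausdorff_dim_le) auto
  also have "\<dots> < ereal (1/3)" using level_dim_bounds(2)[of N] by simp
  finally show ?thesis .
qed

lemma generic_unique_level:
  "generic_C K_set (\<lambda>f. \<exists>!y. hausdorff_dim {x \<in> K_set. f x = y} = topological_hausdorff_dim K_set - 1)"
proof (rule generic_CI[OF compact_K_set K_set_nonempty])
  define \<Q> where "\<Q> = range (\<lambda>(n, k). thin_levels n k) \<union> range crosses_apex_level \<union> range almost_injective"
  show "countable \<Q>" by (auto simp: \<Q>_def)
  show "robustly_dense K_set Q" if "Q \<in> \<Q>" for Q
    using that robustly_dense_thin_levels robustly_dense_crosses_apex_level robustly_dense_almost_injective
    by (auto simp: \<Q>_def)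
  fix h assume h: "continuous_on K_set h" and Q: "\<And>Q. Q \<in> \<Q> \<Longrightarrow> Q h"
  have thin: "thin_levels n k h" for n k
    by (rule Q) (unfold \<Q>_def, intro UnI1 image_eqI[of _ _ "(n, k)"], auto)
  have cross: "crosses_apex_level N h" and inj: "almost_injective k h" for N k
    by (rule Q; simp add: \<Q>_def)+
  have "topological_hausdorff_dim K_set - 1 = ereal (1/3)"
    by (simp add: topological_hausdorff_dim_K_set one_ereal_def)
  then show "\<exists>!y. hausdorff_dim {x \<in> K_set. h x = y} = topological_hausdorff_dim K_set - 1"
    using apex_level_dim[OF h thin inj cross] other_level_dim[OF h thin inj]
    by (intro ex1I[of _ "h apex"]) (auto simp: less_le)
qed

theorem theorem4p5:
  shows "\<exists>K :: (real ^ 2) set. compact K \<and> ifs_attractor K \<and>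
           generic_C K (\<lambda>f. \<exists>!y. hausdorff_dim {x \<in> K. f x = y} = topological_hausdorff_dim K - 1)"
  using compact_K_set ifs_attractor_K_set generic_unique_level by blast

end
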